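(* Let $K\subset\mathbb{R}^n$ be a convex body. Let $\mu$ be a measure on $\mathbb{R}^n$ given by $d\mu(x)=\phi(x)\,dx$, where $\phi:\mathbb{R}^n\to[0,\infty)$ is an even quasi-concave function. Then $$\mu(K-K)\ge\mu(2K).$$ Equality holds only if $K\cap\frac12\mathrm{supp}\,\phi$ is centrally symmetric. Moreover, if $K$ is centrally symmetric with respect to the origin, then equality holds.
   Context: A convex body is a compact convex set with non-empty interior. $K-K=\{a-b:a,b\in K\}$. $\phi$ is quasi-concave if $\phi((1-\lambda)x+\lambda y)\ge\min\{\phi(x),\phi(y)\}$ for all $x,y\in\mathbb{R}^n$, $\lambda\in(0,1)$; even means $\phi(-x)=\phi(x)$. $\mathrm{supp}\,\phi$ is the closure of $\{x:\phi(x)>0\}$. A set $A$ is centrally symmetric if there is a point $x$ with $A-x=-(A-x)$; it is centrally symmetric with respect to the origin if $A=-A$.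
   Formalization: The clause "Equality holds only if" is stated for μ not the zero measure; otherwise it fails, e.g. n=3, φ the indicator of the flat square [-1,1]²×{0}, and K a small tetrahedron around 0 that meets the plane of the square in a triangle. *)

theory Defs
  imports "HOL-Analysis.Analysis"
begin

definition convex_body :: "'a::euclidean_space set \<Rightarrow> bool" where
  "convex_body K \<longleftrightarrow> convex K \<and> compact K \<and> interior K \<noteq> {}"

definition difference_body :: "'a::euclidean_space set \<Rightarrow> 'a set" where
  "difference_body K = {a - b | a b. a \<in> K \<and> b \<in> K}"

definition quasi_concave :: "('a::real_vector \<Rightarrow> real) \<Rightarrow> bool" where
  "quasi_concave \<phi> \<longleftrightarrow>
     (\<forall>x y. \<forall>u\<in>{0<..<1}. \<phi> ((1 - u) *\<^sub>R x + u *\<^sub>R y) \<ge> min (\<phi> x) (\<phi> y))"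

definition even_function :: "('a::real_vector \<Rightarrow> real) \<Rightarrow> bool" where
  "even_function \<phi> \<longleftrightarrow> (\<forall>x. \<phi> (- x) = \<phi> x)"

definition supp :: "('a::real_normed_vector \<Rightarrow> real) \<Rightarrow> 'a set" where
  "supp \<phi> = closure {x. \<phi> x > 0}"

definition origin_symmetric :: "'a::real_vector set \<Rightarrow> bool" where
  "origin_symmetric A \<longleftrightarrow> A = uminus ` A"

text \<open>The centre need not belong to the set; the empty set is centrally symmetric.\<close>
definition centrally_symmetric :: "'a::real_vector set \<Rightarrow> bool" where
  "centrally_symmetric A \<longleftrightarrow> (\<exists>x. origin_symmetric ((\<lambda>a. a - x) ` A))"

text \<open>
  The density is taken with respect to the completed measure \<^const>\<open>lebesgue\<close>: the superlevel
  sets of a quasi-concave function are convex, hence Lebesgue measurable (as shown below), but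
  they need not be Borel sets. So no measurability hypothesis on \<open>\<phi>\<close> is needed.
\<close>
definition density_measure :: "('a::euclidean_space \<Rightarrow> real) \<Rightarrow> 'a measure" where
  "density_measure \<phi> = density lebesgue (\<lambda>x. ennreal (\<phi> x))"

lemma convex_imp_sets_lebesgue:
  fixes S :: "'a::euclidean_space set"
  assumes "convex S"
  shows "S \<in> sets lebesgue"
proof -
  have "S \<inter> ball 0 (real n) \<in> sets lebesgue" for n
    using assms by (intro fmeasurableD measurable_convex convex_Int convex_ball bounded_Int) auto
  then have "(\<Union>n. S \<inter> ball 0 (real n)) \<in> sets lebesgue"
    by blast
  moreover have "S = (\<Union>n. S \<inter> ball 0 (real n))"
    using reals_Archimedean2 by auto
  ultimately show ?thesis
    by simp
qed

lemma quasi_concave_imp_measurable: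
  fixes \<phi> :: "'a::euclidean_space \<Rightarrow> real"
  assumes "quasi_concave \<phi>"
  shows "\<phi> \<in> borel_measurable lebesgue"
proof -
  have "convex {x. t \<le> \<phi> x}" for t
  proof (unfold convex_alt, clarsimp)
    fix x y and u :: real
    assume *: "t \<le> \<phi> x" "t \<le> \<phi> y" "0 \<le> u" "u \<le> 1"
    show "t \<le> \<phi> ((1 - u) *\<^sub>R x + u *\<^sub>R y)"
    proof (cases "u = 0 \<or> u = 1")
      case False
      then have "min (\<phi> x) (\<phi> y) \<le> \<phi> ((1 - u) *\<^sub>R x + u *\<^sub>R y)"
        using assms * unfolding quasi_concave_def by auto
      with * show ?thesis by linarith
    qed (use * in auto)
  qed
  then show ?thesis
    by (auto simp: borel_measurable_iff_ge intro!: convex_imp_sets_lebesgue)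
qed

end

theory Submission
  imports Defs "HOL-Probability.Distribution_Functions"
begin

text \<open>
  Every superlevel set \<open>L\<close> of an even quasi-concave \<open>\<phi>\<close> is convex and symmetric about the origin, and
  by the layer cake formula \<open>\<mu>\<close> is the integral over the levels \<open>t > 0\<close> of Lebesgue measure restricted
  to the superlevel sets. Fix one \<open>L\<close> and let \<open>N = K \<inter> (1/2) L\<close>. Then \<open>2 N = 2 K \<inter> L\<close>, while \<open>N - N\<close>
  lies in \<open>(K - K) \<inter> L\<close> since \<open>L\<close> is symmetric and convex. The Brunn--Minkowski inequality for \<open>N\<close> and
  \<open>-N\<close> gives \<open>vol (N - N) \<ge> vol (2 N)\<close>, hence the inequality on each level (\<open>slice_inequality\<close>). If
  \<open>K = -K\<close>, then \<open>K - K = 2 K\<close>.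

  Suppose that the two measures agree and that \<open>\<mu>\<close> is not zero. The volumes of
  \<open>2 K \<inter> {\<phi> > t}\<close> and \<open>(K - K) \<inter> {\<phi> > t}\<close> then agree for the level \<open>t = 0\<close> too: a strict gap at
  \<open>t = 0\<close> would persist, bounded away from zero, on an interval of small levels
  (\<open>level_gap_imp_strict\<close>). At \<open>t = 0\<close> the body \<open>N\<close>, formed with the closure of \<open>{\<phi> > 0}\<close>, is
  \<open>K \<inter> (1/2) supp \<phi>\<close>, so everything reduces to the equality case: a convex body \<open>A\<close> for which
  \<open>(A - A)/2\<close> has the volume of \<open>A\<close> is centrally symmetric (\<open>halfdiff_volume_eq_imp_symmetric\<close>).

  The Brunn--Minkowski inequality is used in the multiplicative form
  \<open>vol A * vol B \<le> (vol ((A + B)/2))^2\<close>, which follows from the Prekopa--Leindler inequality by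
  induction on the dimension.

  For the equality case let \<open>B = -A\<close>, \<open>D = (A + B)/2\<close>, fix a direction \<open>\<theta>\<close>, and let \<open>F\<close>, \<open>G\<close>, \<open>H\<close> be the
  distribution functions of \<open>\<theta> \<bullet> x\<close> for \<open>x\<close> uniform on \<open>A\<close>, \<open>B\<close>, \<open>D\<close>. Applying the inequality to pieces
  cut off by half-spaces gives \<open>F s * G t \<le> (H ((s + t)/2))^2\<close> and the same for the upper tails. If
  \<open>a\<close> and \<open>b\<close> denote the quantile functions of \<open>F\<close> and \<open>G\<close>, the two bounds together show that \<open>(a p + b p)/2\<close>
  is the \<open>p\<close>-quantile of \<open>H\<close>, and then the first bound gives
  \<open>a p + b p \<le> a (k * p) + b (p / k)\<close>. Along a geometric progression this compares each increment of
  \<open>b\<close> with the next increment of \<open>a\<close>; letting the ratio \<open>k\<close> tend to 1 yields \<open>b q - b p \<le> a q - a p\<close>, and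
  by exchanging the roles equality. So \<open>F\<close> is a translate of \<open>G\<close>, which means that every
  one-dimensional marginal of \<open>A\<close> is symmetric. The centre of symmetry is necessarily the mean, so
  all these centres come from a single point, the centroid \<open>g\<close>; separating a point \<open>2 g - x\<close> outside
  \<open>A\<close> from \<open>A\<close> by a hyperplane contradicts the symmetry of the marginal in the normal direction.
\<close>

section \<open>The Prekopa--Leindler and Brunn--Minkowski inequalities\<close>

text \<open>
  A value \<open>f x\<close> is the length of the set of levels \<open>t > 0\<close> below it, so the formula is Tonelli's
  theorem for the region under the graph.
\<close>
lemma nn_integral_layer_cake:
  fixes f :: "'a \<Rightarrow> ennreal"
  assumes "sigma_finite_measure M" and [measurable]: "f \<in> borel_measurable M"
  shows "(\<integral>\<^sup>+x. f x \<partial>M) =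
    (\<integral>\<^sup>+t. emeasure M {x\<in>space M. ennreal t < f x} * indicator {0<..} t \<partial>lborel)"
proof -
  interpret M: sigma_finite_measure M by fact
  interpret P: pair_sigma_finite M "lborel :: real measure" ..
  define u :: "'a \<times> real \<Rightarrow> ennreal"
    where "u p = (if 0 < snd p \<and> ennreal (snd p) < f (fst p) then 1 else 0)" for p
  have [measurable]: "u \<in> borel_measurable (M \<Otimes>\<^sub>M lborel)"
    unfolding u_def by measurable
  have "(\<integral>\<^sup>+t. u (x, t) \<partial>lborel) = f x" for x
  proof (cases "f x")
    case (real r)
    have "(\<integral>\<^sup>+t. u (x, t) \<partial>lborel) = (\<integral>\<^sup>+t. indicator {0<..<r} t \<partial>lborel)"
      using real by (intro nn_integral_cong) (auto simp: u_def indicator_def ennreal_less_iff)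
    also have "\<dots> = f x"
      using real by simp
    finally show ?thesis .
  next
    case top
    have "(\<integral>\<^sup>+t. u (x, t) \<partial>lborel) = (\<integral>\<^sup>+t. indicator {0::real<..} t \<partial>lborel)"
      using top by (intro nn_integral_cong) (auto simp: u_def indicator_def)
    also have "\<dots> = emeasure lborel {0::real<..}"
      by simp
    also have "\<dots> = \<infinity>"
    proof (rule ccontr)
      assume "emeasure lborel {0::real<..} \<noteq> \<infinity>"
      then obtain r where r: "emeasure lborel {0::real<..} = ennreal r" "r \<ge> 0"
        by (cases "emeasure lborel {0::real<..}") auto
      have "emeasure lborel {0<..<r + 1} \<le> emeasure lborel {0::real<..}"
        by (rule emeasure_mono) auto
      then show False using r by (simp add: ennreal_le_iff)
    qed
    finally show ?thesis using top by simp
  qed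
  then have "(\<integral>\<^sup>+x. f x \<partial>M) = (\<integral>\<^sup>+x. \<integral>\<^sup>+t. u (x, t) \<partial>lborel \<partial>M)"
    by simp
  also have "\<dots> = (\<integral>\<^sup>+t. \<integral>\<^sup>+x. u (x, t) \<partial>M \<partial>lborel)"
    by (subst P.Fubini) simp_all
  also have "\<dots> = (\<integral>\<^sup>+t. emeasure M {x\<in>space M. ennreal t < f x} * indicator {0<..} t \<partial>lborel)"
  proof (rule nn_integral_cong)
    fix t :: real
    have "(\<integral>\<^sup>+x. u (x, t) \<partial>M) =
        (\<integral>\<^sup>+x. indicator {0<..} t * indicator {x\<in>space M. ennreal t < f x} x \<partial>M)"
      by (intro nn_integral_cong) (auto simp: u_def indicator_def)
    also have "\<dots> = indicator {0<..} t * emeasure M {x\<in>space M. ennreal t < f x}"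
      by (subst nn_integral_cmult_indicator) auto
    finally show "(\<integral>\<^sup>+x. u (x, t) \<partial>M) =
        emeasure M {x\<in>space M. ennreal t < f x} * indicator {0<..} t"
      by (simp add: mult.commute)
  qed
  finally show ?thesis .
qed

lemma borel_measurable_superlevel:
  fixes f :: "'a \<Rightarrow> ennreal"
  assumes "sigma_finite_measure M" and [measurable]: "f \<in> borel_measurable M"
  shows "(\<lambda>t::real. emeasure M {x\<in>space M. ennreal t < f x}) \<in> borel_measurable borel"
proof -
  interpret sigma_finite_measure M by fact
  show ?thesis by measurable
qed

lemma emeasure_lborel_translation:
  fixes S :: "'a::euclidean_space set"
  assumes [measurable]: "S \<in> sets borel"
  shows "emeasure lborel ((+) a ` S) = emeasure lborel S"
proof -
  have "(+) a ` S = (\<lambda>x. x - a) -` S" by force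
  moreover have "(\<lambda>x. x - a) -` S \<in> sets borel"
    using measurable_sets_borel[of "\<lambda>x. x - a" borel S] assms by measurable
  ultimately have "emeasure lborel ((+) a ` S) = emeasure lebesgue ((+) a ` S)"
    by simp
  also have "\<dots> = emeasure lebesgue S"
    using emeasure_lebesgue_affine[of 1 a S] by (simp add: add.commute[of a] image_def)
  finally show ?thesis by simp
qed

text \<open>
  The sets \<open>min Y + X\<close> and \<open>max X + Y\<close> both lie in \<open>X + Y\<close> and meet only in the point
  \<open>max X + min Y\<close>, so the length of \<open>X + Y\<close> is at least the sum of the lengths.
\<close>
lemma compact_midpoint_length:
  fixes X Y Z :: "real set"
  assumes "compact X" "compact Y" "X \<noteq> {}" "Y \<noteq> {}" and Z[measurable]: "Z \<in> sets borel"
    and mid: "\<And>x y. x \<in> X \<Longrightarrow> y \<in> Y \<Longrightarrow> (x + y) / 2 \<in> Z"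
  shows "emeasure lborel X + emeasure lborel Y \<le> 2 * emeasure lborel Z"
proof -
  obtain x where x: "x \<in> X" "\<And>z. z \<in> X \<Longrightarrow> z \<le> x"
    using compact_attains_sup[of X] assms by auto
  obtain y where y: "y \<in> Y" "\<And>z. z \<in> Y \<Longrightarrow> y \<le> z"
    using compact_attains_inf[of Y] assms by auto
  have bor[measurable]: "X \<in> sets borel" "Y \<in> sets borel"
    using assms(1,2) by (auto intro: borel_compact)
  define W where "W = (\<lambda>z. z / 2) -` Z"
  have W[measurable]: "W \<in> sets borel"
    unfolding W_def using measurable_sets_borel[of "\<lambda>z. z / 2" borel Z] by measurable
  have cl: "closed ((+) y ` X)" "closed ((+) x ` Y)"
    using assms(1,2) by (auto intro!: closed_translation simp: compact_imp_closed)
  have meas: "(+) y ` X \<in> sets lborel" "(+) x ` Y \<in> sets lborel"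
    using cl by auto
  have "(+) y ` X \<inter> (+) x ` Y \<subseteq> {x + y}"
  proof
    fix z assume "z \<in> (+) y ` X \<inter> (+) x ` Y"
    then obtain u v where "u \<in> X" "v \<in> Y" "z = y + u" "z = x + v" by auto
    with x(2)[of u] y(2)[of v] show "z \<in> {x + y}" by auto
  qed
  then have "emeasure lborel ((+) y ` X \<inter> (+) x ` Y) \<le> emeasure lborel {x + y}"
    by (intro emeasure_mono) auto
  then have "emeasure lborel ((+) y ` X \<union> (+) x ` Y) = emeasure lborel X + emeasure lborel Y"
    using emeasure_Un_Int[OF meas] by (simp add: emeasure_lborel_translation)
  moreover have "(+) y ` X \<union> (+) x ` Y \<subseteq> W"
    using mid[OF _ y(1)] mid[OF x(1)] by (auto simp: W_def add.commute[of y])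
  ultimately have "emeasure lborel X + emeasure lborel Y \<le> emeasure lborel W"
    using emeasure_mono[of "(+) y ` X \<union> (+) x ` Y" W lborel] by simp
  also have "W = (*\<^sub>R) 2 ` Z"
    by (force simp: W_def image_iff)
  also have "emeasure lborel ((*\<^sub>R) 2 ` Z) = 2 * emeasure lborel Z"
    using emeasure_lebesgue_affine[of 2 0 Z] W
    unfolding \<open>W = (*\<^sub>R) 2 ` Z\<close> by simp
  finally show ?thesis .
qed

text \<open>
  Inner regularity by compact sets, reduced to that by closed sets by first cutting \<open>X\<close> with a large
  interval.
\<close>
lemma inner_compact_lborel:
  fixes X :: "real set"
  assumes [measurable]: "X \<in> sets borel" and "c < emeasure lborel X"
  obtains C where "compact C" "C \<subseteq> X" "c < emeasure lborel C"
proof -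
  have "(SUP n. emeasure lborel (X \<inter> {- real n..real n})) = emeasure lborel (\<Union>n. X \<inter> {- real n..real n})"
    by (intro SUP_emeasure_incseq) (auto simp: incseq_def)
  also have "(\<Union>n. X \<inter> {- real n..real n}) = X"
    by (auto) (metis abs_le_iff minus_le_iff real_arch_simple)
  finally have "c < (SUP n. emeasure lborel (X \<inter> {- real n..real n}))"
    using assms(2) by (simp only:)
  then obtain n where n: "c < emeasure lborel (X \<inter> {- real n..real n})"
    by (auto simp only: less_SUP_iff)
  let ?X = "X \<inter> {- real n..real n}"
  have fin: "emeasure lborel ?X < \<infinity>"
    by (rule order.strict_trans1[OF emeasure_mono[of _ "{- real n..real n}"]]) auto
  obtain u where u: "emeasure lborel ?X = ennreal u" "u \<ge> 0"
    using fin by (cases "emeasure lborel ?X") auto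
  obtain v where v: "c = ennreal v" "v \<ge> 0"
    using n fin by (cases c) auto
  have uv: "v < u" using n u v by (simp add: ennreal_less_iff)
  obtain T where T: "closed T" "T \<subseteq> ?X" "?X - T \<in> lmeasurable" "emeasure lebesgue (?X - T) < ennreal (u - v)"
    using sets_lebesgue_inner_closed[of ?X "u - v"] uv by auto
  have bT[measurable]: "T \<in> sets borel" using T(1) by auto
  have "T \<union> (?X - T) = ?X" using T(2) by blast
  then have le: "emeasure lborel ?X = emeasure lborel T + emeasure lborel (?X - T)"
    using plus_emeasure[of T lborel "?X - T"] by simp
  show ?thesis
  proof
    have "bounded T" by (rule bounded_subset[OF _ T(2)]) (auto intro: bounded_Int)
    then show "compact T" using T(1) by (simp add: compact_eq_bounded_closed)
    show "T \<subseteq> X" using T(2) by blast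
    obtain w where w: "emeasure lborel (?X - T) = ennreal w" "w \<ge> 0" "w < u - v"
      using T(4) by (cases "emeasure lborel (?X - T)") (auto simp: ennreal_less_iff)
    obtain z where z: "emeasure lborel T = ennreal z" "z \<ge> 0"
      using le u by (cases "emeasure lborel T") auto
    have "u = z + w" using le u w z by (simp add: ennreal_plus[symmetric] del: ennreal_plus)
    then show "c < emeasure lborel T" using v z w by (simp add: ennreal_less_iff)
  qed
qed

text \<open>
  The one-dimensional Brunn--Minkowski inequality for Borel sets, by exhausting \<open>X\<close> and \<open>Y\<close> with
  nonempty compact sets.
\<close>
lemma midpoint_length:
  fixes X Y Z :: "real set"
  assumes [measurable]: "X \<in> sets borel" "Y \<in> sets borel" "Z \<in> sets borel"
    and ne: "X \<noteq> {}" "Y \<noteq> {}"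
    and mid: "\<And>x y. x \<in> X \<Longrightarrow> y \<in> Y \<Longrightarrow> (x + y) / 2 \<in> Z"
  shows "emeasure lborel X + emeasure lborel Y \<le> 2 * emeasure lborel Z"
proof (rule ccontr)
  assume "\<not> ?thesis"
  then have less: "2 * emeasure lborel Z < emeasure lborel X + emeasure lborel Y" by simp
  have inner: "\<exists>C. compact C \<and> C \<noteq> {} \<and> C \<subseteq> S \<and> c \<le> emeasure lborel C"
    if S: "S \<in> sets borel" "S \<noteq> {}" "c < emeasure lborel S \<or> c = 0" for S :: "real set" and c
  proof (cases "c = 0")
    case True
    from S obtain x where "x \<in> S" by auto
    then show ?thesis using True by (intro exI[of _ "{x}"]) auto
  next
    case False
    then obtain C where "compact C" "C \<subseteq> S" "c < emeasure lborel C"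
      using inner_compact_lborel[of S c] S by metis
    then show ?thesis by (intro exI[of _ C]) (auto intro: less_imp_le)
  qed
  (* Lower bounds c and d for the two lengths that already violate the inequality. The value 0 is
     admitted because a null set contains no compact set of positive length, but it does contain
     a point. *)
  have "\<exists>c d. 2 * emeasure lborel Z < c + d \<and> (c < emeasure lborel X \<or> c = 0)
      \<and> (d < emeasure lborel Y \<or> d = 0)"
  proof (cases "2 * emeasure lborel Z < emeasure lborel X \<or> 2 * emeasure lborel Z < emeasure lborel Y")
    case True
    then show ?thesis
    proof
      assume "2 * emeasure lborel Z < emeasure lborel Y"
      then obtain d where "2 * emeasure lborel Z < d" "d < emeasure lborel Y"
        by (auto dest: dense)
      then show ?thesis by (intro exI[of _ 0] exI[of _ d]) auto
    next
      assume "2 * emeasure lborel Z < emeasure lborel X"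
      then obtain d where "2 * emeasure lborel Z < d" "d < emeasure lborel X"
        by (auto dest: dense)
      then show ?thesis by (intro exI[of _ d] exI[of _ 0]) auto
    qed
  next
    case False
    then have le: "emeasure lborel X \<le> 2 * emeasure lborel Z" "emeasure lborel Y \<le> 2 * emeasure lborel Z"
      by auto
    have "emeasure lborel Z \<noteq> \<infinity>" using less by (auto simp: ennreal_mult_top)
    then obtain z where z: "emeasure lborel Z = ennreal z" "z \<ge> 0" by (cases "emeasure lborel Z") auto
    then have Z2: "2 * emeasure lborel Z = ennreal (2 * z)" by (simp add: ennreal_mult)
    obtain x where x: "emeasure lborel X = ennreal x" "x \<ge> 0"
      using le(1) unfolding Z2 by (cases "emeasure lborel X") (auto simp: top_unique)
    obtain y where y: "emeasure lborel Y = ennreal y" "y \<ge> 0"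
      using le(2) unfolding Z2 by (cases "emeasure lborel Y") (auto simp: top_unique)
    have xyz: "x \<le> 2 * z" "y \<le> 2 * z" "2 * z < x + y"
      using le less x y z unfolding Z2
      by (auto simp: ennreal_le_iff ennreal_less_iff ennreal_plus[symmetric] simp del: ennreal_plus)
    define e where "e = (x + y - 2 * z) / 3"
    have "3 * e = x + y - 2 * z" by (simp add: e_def)
    then have e: "0 < e" "2 * z < x - e + (y - e)"
      using xyz by linarith+
    then obtain p q where pq: "0 \<le> p" "p < x" "0 \<le> q" "q < y" "2 * z < p + q"
      using xyz x y by (intro that[of "max 0 (x - e)" "max 0 (y - e)"]) (auto simp: max_def)
    then have "2 * emeasure lborel Z < ennreal p + ennreal q" "ennreal p < emeasure lborel X"
        "ennreal q < emeasure lborel Y"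
      unfolding Z2 x(1) y(1) using z(2)
      by (simp_all add: ennreal_less_iff ennreal_plus[symmetric] del: ennreal_plus)
    then show ?thesis by blast
  qed
  then obtain c d where cd: "2 * emeasure lborel Z < c + d"
    "c < emeasure lborel X \<or> c = 0" "d < emeasure lborel Y \<or> d = 0" by auto
  obtain C where C: "compact C" "C \<noteq> {}" "C \<subseteq> X" "c \<le> emeasure lborel C"
    using inner[of X c] ne cd by auto
  obtain D where D: "compact D" "D \<noteq> {}" "D \<subseteq> Y" "d \<le> emeasure lborel D"
    using inner[of Y d] ne cd by auto
  have "c + d \<le> emeasure lborel C + emeasure lborel D"
    using C D by (intro add_mono)
  also have "\<dots> \<le> 2 * emeasure lborel Z"
    using C D mid by (intro compact_midpoint_length) auto
  finally show False using cd by auto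
qed

lemma ennreal_mult_le_square_of_mean:
  fixes u v w :: ennreal
  assumes "u + v \<le> 2 * w"
  shows "u * v \<le> w ^ 2"
proof (cases "w = \<infinity>")
  case True
  then show ?thesis by simp
next
  case False
  then obtain c where c: "w = ennreal c" "c \<ge> 0" by (cases w) auto
  have w2: "2 * w < \<infinity>" using False by (simp add: ennreal_mult_less_top top.not_eq_extremum)
  then have "u + v < \<infinity>" using assms by (rule order.strict_trans1[rotated])
  then obtain a b where ab: "u = ennreal a" "a \<ge> 0" "v = ennreal b" "b \<ge> 0"
    by (cases u; cases v) auto
  have two: "(2::ennreal) = ennreal 2" by simp
  have "ennreal (a + b) \<le> ennreal (2 * c)"
    using assms ab c by (simp add: ennreal_mult)
  then have "a + b \<le> 2 * c" using c by (simp add: ennreal_le_iff)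
  then have "(a + b)^2 \<le> (2 * c)^2" using ab by (intro power_mono) auto
  moreover have "0 \<le> (a - b)^2" by simp
  ultimately have "a * b \<le> c ^ 2" by (simp add: power2_eq_square algebra_simps)
  then show ?thesis using ab c by (simp add: ennreal_mult[symmetric] ennreal_power)
qed

text \<open>
  If both suprema equal 1, the superlevel sets of \<open>f\<close> and \<open>g\<close> at each level \<open>t\<close> in \<open>(0, 1)\<close> are nonempty
  and their midpoints lie in the superlevel set of \<open>h\<close>. Integrating the one-dimensional
  Brunn--Minkowski inequality over \<open>t\<close> gives this additive form, which is stronger than the
  multiplicative one.
\<close>
lemma prekopa_leindler_real_normalized:
  fixes f g h :: "real \<Rightarrow> ennreal"
  assumes [measurable]: "f \<in> borel_measurable borel" "g \<in> borel_measurable borel" "h \<in> borel_measurable borel"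
    and f1: "(SUP x. f x) = 1" and g1: "(SUP x. g x) = 1"
    and fgh: "\<And>x y. f x * g y \<le> h ((x + y) / 2) ^ 2"
  shows "(\<integral>\<^sup>+x. f x \<partial>lborel) + (\<integral>\<^sup>+x. g x \<partial>lborel) \<le> 2 * (\<integral>\<^sup>+x. h x \<partial>lborel)"
proof -
  note cake = nn_integral_layer_cake[OF sigma_finite_lborel]
  have f_le: "f x \<le> 1" "g x \<le> 1" for x
    using f1 g1 by (metis SUP_upper UNIV_I)+
  have level: "emeasure lborel {x. ennreal t < f x} * indicator {0<..} t +
      emeasure lborel {x. ennreal t < g x} * indicator {0<..} t
      \<le> 2 * (emeasure lborel {x. ennreal t < h x} * indicator {0<..} t)" for t :: real
  proof (cases "0 < t \<and> t < 1")
    case False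
    have "\<not> ennreal t < f x" "\<not> ennreal t < g x" if "t \<ge> 1" for x
      using f_le[of x] that by (metis ennreal_1 ennreal_leI leD order_trans)+
    with False show ?thesis by (cases "t \<ge> 1") auto
  next
    case True
    then have t: "ennreal t < 1" using ennreal_less_iff[of t 1] by simp
    have "\<exists>x. ennreal t < f x" "\<exists>x. ennreal t < g x"
      using t f1 g1 less_SUP_iff[of "ennreal t" f UNIV] less_SUP_iff[of "ennreal t" g UNIV] by auto
    moreover have "ennreal t < h ((x + y) / 2)" if "ennreal t < f x" "ennreal t < g y" for x y
    proof (rule ccontr)
      assume "\<not> ?thesis"
      then have le: "h ((x + y) / 2) \<le> ennreal t" by simp
      obtain a where a: "f x = ennreal a" "a \<ge> 0" using f_le(1)[of x] by (cases "f x") (auto simp: top_unique)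
      obtain b where b: "g y = ennreal b" "b \<ge> 0" using f_le(2)[of y] by (cases "g y") (auto simp: top_unique)
      have "ennreal (a * b) \<le> ennreal t ^ 2"
        using order_trans[OF fgh[of x y] power_mono[OF le, of 2]] a b by (simp add: ennreal_mult)
      also have "ennreal t ^ 2 = ennreal (t * t)"
        using True by (simp add: ennreal_mult power2_eq_square)
      finally have "a * b \<le> t * t" using True by (subst (asm) ennreal_le_iff) auto
      moreover have "t * t < a * b"
        using that a b True by (intro mult_strict_mono) (auto simp: ennreal_less_iff)
      ultimately show False by simp
    qed
    ultimately have "emeasure lborel {x. ennreal t < f x} + emeasure lborel {x. ennreal t < g x}
      \<le> 2 * emeasure lborel {x. ennreal t < h x}"
      by (intro midpoint_length) auto
    with True show ?thesis by simp
  qed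
  have "(\<integral>\<^sup>+x. f x \<partial>lborel) + (\<integral>\<^sup>+x. g x \<partial>lborel) =
      (\<integral>\<^sup>+t. emeasure lborel {x. ennreal t < f x} * indicator {0<..} t +
        emeasure lborel {x. ennreal t < g x} * indicator {0<..} t \<partial>lborel)"
    using cake[of f] cake[of g] by (subst nn_integral_add) auto
  also have "\<dots> \<le> (\<integral>\<^sup>+t. 2 * (emeasure lborel {x. ennreal t < h x} * indicator {0<..} t) \<partial>lborel)"
    by (intro nn_integral_mono level)
  also have "\<dots> = 2 * (\<integral>\<^sup>+x. h x \<partial>lborel)"
    using cake[of h] by (subst nn_integral_cmult) auto
  finally show ?thesis .
qed

text \<open>
  The inequality is homogeneous, so \<open>f\<close> and \<open>g\<close> can be divided by their suprema \<open>a\<close> and \<open>b\<close>, and \<open>h\<close> by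
  the geometric mean of \<open>a\<close> and \<open>b\<close>; the additive form then implies the multiplicative one by the
  inequality between arithmetic and geometric means.
\<close>
lemma prekopa_leindler_real_bounded:
  fixes f g h :: "real \<Rightarrow> ennreal"
  assumes [measurable]: "f \<in> borel_measurable borel" "g \<in> borel_measurable borel" "h \<in> borel_measurable borel"
    and fb: "\<And>x. f x \<le> ennreal A" and gb: "\<And>x. g x \<le> ennreal B"
    and fgh: "\<And>x y. f x * g y \<le> h ((x + y) / 2) ^ 2"
  shows "(\<integral>\<^sup>+x. f x \<partial>lborel) * (\<integral>\<^sup>+x. g x \<partial>lborel) \<le> (\<integral>\<^sup>+x. h x \<partial>lborel) ^ 2"
proof (cases "(SUP x. f x) = 0 \<or> (SUP x. g x) = 0")
  case True
  then have "f = (\<lambda>x. 0) \<or> g = (\<lambda>x. 0)"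
    by (auto simp: SUP_eq_iff bot_ennreal[symmetric] fun_eq_iff simp del: bot_ennreal)
  then show ?thesis by auto
next
  case False
  have "(SUP x. f x) \<le> ennreal A" "(SUP x. g x) \<le> ennreal B"
    by (auto intro!: SUP_least fb gb)
  with False obtain a b where a: "(SUP x. f x) = ennreal a" "a > 0" and b: "(SUP x. g x) = ennreal b" "b > 0"
    by (cases "SUP x. f x"; cases "SUP x. g x") (auto simp: top_unique less_le)
  define c where "c = sqrt (a * b)"
  have c: "c > 0" "c ^ 2 = a * b" using a b by (auto simp: c_def)
  let ?k = "ennreal (1 / (a * b))"
  have split: "(u * ennreal (1 / a)) * (v * ennreal (1 / b)) = u * v * ?k" for u v
    using a(2) b(2) by (simp add: ennreal_mult[symmetric] mult_ac divide_inverse)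
  have square: "(u * ennreal (1 / c)) ^ 2 = u ^ 2 * ?k" for u
    using c by (simp add: power_mult_distrib ennreal_power power_one_over)
  have "(\<integral>\<^sup>+x. f x * ennreal (1 / a) \<partial>lborel) + (\<integral>\<^sup>+x. g x * ennreal (1 / b) \<partial>lborel)
      \<le> 2 * (\<integral>\<^sup>+x. h x * ennreal (1 / c) \<partial>lborel)"
  proof (rule prekopa_leindler_real_normalized)
    show "(SUP x. f x * ennreal (1 / a)) = 1" "(SUP x. g x * ennreal (1 / b)) = 1"
      using a b by (auto simp: SUP_mult_right_ennreal[symmetric] ennreal_mult[symmetric])
    show "f x * ennreal (1 / a) * (g y * ennreal (1 / b)) \<le> (h ((x + y) / 2) * ennreal (1 / c)) ^ 2" for x y
      unfolding split square by (intro mult_right_mono fgh) auto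
  qed auto
  from ennreal_mult_le_square_of_mean[OF this]
  have "(\<integral>\<^sup>+x. f x \<partial>lborel) * (\<integral>\<^sup>+x. g x \<partial>lborel) * ?k \<le> (\<integral>\<^sup>+x. h x \<partial>lborel) ^ 2 * ?k"
    by (simp add: nn_integral_multc split square)
  then have "(\<integral>\<^sup>+x. f x \<partial>lborel) * (\<integral>\<^sup>+x. g x \<partial>lborel) * ?k * ennreal (a * b)
      \<le> (\<integral>\<^sup>+x. h x \<partial>lborel) ^ 2 * ?k * ennreal (a * b)"
    by (rule mult_right_mono) simp
  moreover have "?k * ennreal (a * b) = 1"
    using a b by (simp add: ennreal_mult[symmetric])
  ultimately show ?thesis by (simp add: mult.assoc)
qed

lemma SUP_min_of_nat_ennreal: "(SUP n. min x (of_nat n)) = (x::ennreal)"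
proof (rule antisym)
  show "(SUP n. min x (of_nat n)) \<le> x" by (auto intro!: SUP_least)
  show "x \<le> (SUP n. min x (of_nat n))"
  proof (cases x)
    case (real r)
    obtain n where "r \<le> real n" using real_arch_simple by blast
    then have "x \<le> of_nat n" using real by (simp add: ennreal_of_nat_eq_real_of_nat)
    then have "x = min x (of_nat n)" by (simp add: min_absorb1)
    then show ?thesis by (metis SUP_upper UNIV_I)
  next
    case top
    then show ?thesis by (simp add: ennreal_SUP_of_nat_eq_top)
  qed
qed

lemma nn_integral_truncate:
  fixes f :: "'a \<Rightarrow> ennreal"
  assumes [measurable]: "f \<in> borel_measurable M"
  shows "(\<integral>\<^sup>+x. f x \<partial>M) = (SUP n. \<integral>\<^sup>+x. min (f x) (of_nat n) \<partial>M)"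
proof -
  have "(\<integral>\<^sup>+x. f x \<partial>M) = (\<integral>\<^sup>+x. (SUP n. min (f x) (of_nat n)) \<partial>M)"
    by (simp add: SUP_min_of_nat_ennreal)
  also have "\<dots> = (SUP n. \<integral>\<^sup>+x. min (f x) (of_nat n) \<partial>M)"
    by (rule nn_integral_monotone_convergence_SUP)
      (auto simp: incseq_def le_fun_def intro!: min.mono simp del: min.bounded_iff)
  finally show ?thesis .
qed

lemma prekopa_leindler_real:
  fixes f g h :: "real \<Rightarrow> ennreal"
  assumes [measurable]: "f \<in> borel_measurable borel" "g \<in> borel_measurable borel" "h \<in> borel_measurable borel"
    and fgh: "\<And>x y. f x * g y \<le> h ((x + y) / 2) ^ 2"
  shows "(\<integral>\<^sup>+x. f x \<partial>lborel) * (\<integral>\<^sup>+x. g x \<partial>lborel) \<le> (\<integral>\<^sup>+x. h x \<partial>lborel) ^ 2"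
proof -
  have "(\<integral>\<^sup>+x. min (f x) (of_nat m) \<partial>lborel) * (\<integral>\<^sup>+x. min (g x) (of_nat n) \<partial>lborel)
      \<le> (\<integral>\<^sup>+x. h x \<partial>lborel) ^ 2" for m n :: nat
  proof (rule prekopa_leindler_real_bounded[where A = "real m" and B = "real n"])
    show "min (f x) (of_nat m) * min (g y) (of_nat n) \<le> h ((x + y) / 2) ^ 2" for x y
      by (rule order_trans[OF mult_mono fgh]) auto
  qed (auto simp: ennreal_of_nat_eq_real_of_nat)
  then have "(\<integral>\<^sup>+x. min (f x) (of_nat m) \<partial>lborel) * (\<integral>\<^sup>+x. g x \<partial>lborel)
      \<le> (\<integral>\<^sup>+x. h x \<partial>lborel) ^ 2" for m :: nat
    by (subst (2) nn_integral_truncate) (auto simp: SUP_mult_left_ennreal intro!: SUP_least)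
  then show ?thesis
    by (subst (1) nn_integral_truncate) (auto simp: SUP_mult_right_ennreal intro!: SUP_least)
qed

text \<open>
  Induction on the number of coordinates: for fixed \<open>x\<close> and \<open>y\<close> the one-dimensional inequality in the
  new coordinate shows that the partial integrals of \<open>f\<close>, \<open>g\<close> and \<open>h\<close> again satisfy the hypothesis.
  Restriction to \<open>I\<close> keeps the midpoint in the space of the product measure.
\<close>
lemma prekopa_leindler_PiM:
  fixes f g h :: "('i \<Rightarrow> real) \<Rightarrow> ennreal"
  assumes "finite I"
    and "f \<in> borel_measurable (Pi\<^sub>M I (\<lambda>_. lborel))" "g \<in> borel_measurable (Pi\<^sub>M I (\<lambda>_. lborel))"
      "h \<in> borel_measurable (Pi\<^sub>M I (\<lambda>_. lborel))"
    and "\<And>x y. x \<in> space (Pi\<^sub>M I (\<lambda>_. lborel)) \<Longrightarrow> y \<in> space (Pi\<^sub>M I (\<lambda>_. lborel)) \<Longrightarrow>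
      f x * g y \<le> h (\<lambda>i\<in>I. (x i + y i) / 2) ^ 2"
  shows "(\<integral>\<^sup>+x. f x \<partial>Pi\<^sub>M I (\<lambda>_. lborel)) * (\<integral>\<^sup>+x. g x \<partial>Pi\<^sub>M I (\<lambda>_. lborel))
    \<le> (\<integral>\<^sup>+x. h x \<partial>Pi\<^sub>M I (\<lambda>_. lborel)) ^ 2"
  using assms
proof (induction I arbitrary: f g h rule: finite_induct)
  case empty
  interpret product_sigma_finite "\<lambda>_::'i. lborel :: real measure" ..
  show ?case
    using empty(4)[of "\<lambda>_. undefined" "\<lambda>_. undefined"]
    by (simp add: nn_integral_empty space_PiM restrict_def)
next
  case (insert i I)
  interpret product_sigma_finite "\<lambda>_::'i. lborel :: real measure" ..
  let ?P = "Pi\<^sub>M I (\<lambda>_::'i. lborel :: real measure)"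
  note [measurable] = insert.prems(1-3)
  have upd[measurable]: "(\<lambda>t. u (x(i := t))) \<in> borel_measurable borel"
    if "x \<in> space ?P" "u \<in> borel_measurable (Pi\<^sub>M (insert i I) (\<lambda>_. lborel))" for x and u :: "_ \<Rightarrow> ennreal"
    using measurable_comp[OF measurable_component_update that(2), of x] that(1) insert.hyps(2)
    by (simp add: comp_def fun_upd_def)
  have "(\<integral>\<^sup>+x. (\<integral>\<^sup>+t. f (x(i := t)) \<partial>lborel) \<partial>?P) * (\<integral>\<^sup>+x. (\<integral>\<^sup>+t. g (x(i := t)) \<partial>lborel) \<partial>?P)
     \<le> (\<integral>\<^sup>+x. (\<integral>\<^sup>+t. h (x(i := t)) \<partial>lborel) \<partial>?P) ^ 2"
  proof (rule insert.IH)
    fix x y assume x: "x \<in> space ?P" and y: "y \<in> space ?P"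
    have z: "(\<lambda>j\<in>I. (x j + y j) / 2) \<in> space ?P" by (simp add: space_PiM)
    show "(\<integral>\<^sup>+t. f (x(i := t)) \<partial>lborel) * (\<integral>\<^sup>+t. g (y(i := t)) \<partial>lborel)
      \<le> (\<integral>\<^sup>+t. h ((\<lambda>j\<in>I. (x j + y j) / 2)(i := t)) \<partial>lborel) ^ 2"
    proof (rule prekopa_leindler_real)
      fix s t
      have "x(i := s) \<in> space (Pi\<^sub>M (insert i I) (\<lambda>_. lborel))"
           "y(i := t) \<in> space (Pi\<^sub>M (insert i I) (\<lambda>_. lborel))"
        using x y by (auto simp: space_PiM PiE_def extensional_def)
      from insert.prems(4)[OF this]
      have "f (x(i := s)) * g (y(i := t)) \<le> h (\<lambda>j\<in>insert i I. ((x(i := s)) j + (y(i := t)) j) / 2) ^ 2" .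
      also have "(\<lambda>j\<in>insert i I. ((x(i := s)) j + (y(i := t)) j) / 2) =
          (\<lambda>j\<in>I. (x j + y j) / 2)(i := (s + t) / 2)"
        using insert.hyps(2) by (auto simp: fun_eq_iff)
      finally show "f (x(i := s)) * g (y(i := t)) \<le> h ((\<lambda>j\<in>I. (x j + y j) / 2)(i := (s + t) / 2)) ^ 2" .
    qed (use x y z upd insert.prems(1-3) in auto)
  qed measurable
  then show ?case
    by (simp add: product_nn_integral_insert[OF insert.hyps(1,2)] insert.prems(1-3))
qed

lemma prekopa_leindler:
  fixes f g h :: "'a::euclidean_space \<Rightarrow> ennreal"
  assumes [measurable]: "f \<in> borel_measurable borel" "g \<in> borel_measurable borel" "h \<in> borel_measurable borel"
    and fgh: "\<And>x y. f x * g y \<le> h ((1/2) *\<^sub>R (x + y)) ^ 2"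
  shows "(\<integral>\<^sup>+x. f x \<partial>lborel) * (\<integral>\<^sup>+x. g x \<partial>lborel) \<le> (\<integral>\<^sup>+x. h x \<partial>lborel) ^ 2"
proof -
  let ?P = "Pi\<^sub>M (Basis :: 'a set) (\<lambda>_. lborel :: real measure)"
  define S :: "('a \<Rightarrow> real) \<Rightarrow> 'a" where "S x = (\<Sum>b\<in>Basis. x b *\<^sub>R b)" for x
  have [measurable]: "S \<in> measurable ?P borel" unfolding S_def by measurable
  have int: "(\<integral>\<^sup>+x. u x \<partial>lborel) = (\<integral>\<^sup>+x. u (S x) \<partial>?P)"
    if "u \<in> borel_measurable borel" for u :: "'a \<Rightarrow> ennreal"
    using that by (subst lborel_eq) (simp add: nn_integral_distr S_def[symmetric])
  have mid: "S (\<lambda>b\<in>Basis. (x b + y b) / 2) = (1/2) *\<^sub>R (S x + S y)" for x y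
    by (simp add: S_def sum.distrib[symmetric] scaleR_sum_right scaleR_add_left[symmetric] add_divide_distrib)
  show ?thesis
    unfolding int[OF assms(1)] int[OF assms(2)] int[OF assms(3)]
    by (rule prekopa_leindler_PiM) (auto simp: mid fgh)
qed

text \<open>
  The Prekopa--Leindler inequality for indicator functions.
\<close>
lemma brunn_minkowski_midpoint:
  fixes A B C :: "'a::euclidean_space set"
  assumes "A \<in> sets borel" "B \<in> sets borel" "C \<in> sets borel"
    and "\<And>x y. x \<in> A \<Longrightarrow> y \<in> B \<Longrightarrow> (1/2) *\<^sub>R (x + y) \<in> C"
  shows "emeasure lborel A * emeasure lborel B \<le> emeasure lborel C ^ 2"
proof -
  have "indicator A x * indicator B y \<le> (indicator C ((1/2) *\<^sub>R (x + y)) ^ 2 :: ennreal)" for x y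
    using assms(4)[of x y] by (auto simp: indicator_def)
  then show ?thesis
    using prekopa_leindler[of "indicator A" "indicator B" "indicator C"] assms(1-3) by simp
qed

section \<open>Distribution functions with equality in the midpoint inequality\<close>

definition continuous_cdf :: "(real \<Rightarrow> real) \<Rightarrow> bool" where
  "continuous_cdf F \<longleftrightarrow> mono F \<and> continuous_on UNIV F \<and> (F \<longlongrightarrow> 0) at_bot \<and> (F \<longlongrightarrow> 1) at_top"

lemma continuous_cdf_bounds:
  assumes "continuous_cdf F"
  shows "0 \<le> F s" "F s \<le> 1"
proof -
  have F: "mono F" "(F \<longlongrightarrow> 0) at_bot" "(F \<longlongrightarrow> 1) at_top"
    using assms by (auto simp: continuous_cdf_def)
  show "0 \<le> F s"
    by (intro tendsto_upperbound[OF F(2)] eventually_mono[OF eventually_le_at_bot[of s]])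
      (auto intro: monoD[OF F(1)])
  show "F s \<le> 1"
    by (intro tendsto_lowerbound[OF F(3)] eventually_mono[OF eventually_ge_at_top[of s]])
      (auto intro: monoD[OF F(1)])
qed

lemma continuous_cdf_surj:
  assumes "continuous_cdf F" "0 < p" "p < 1"
  obtains s where "F s = p"
proof -
  have F: "(F \<longlongrightarrow> 0) at_bot" "(F \<longlongrightarrow> 1) at_top" "continuous_on UNIV F"
    using assms by (auto simp: continuous_cdf_def)
  obtain u where u: "F u < p"
    using order_tendstoD(2)[OF F(1) assms(2)] by (auto simp: eventually_at_bot_linorder)
  obtain v where v: "p < F v"
    using order_tendstoD(1)[OF F(2) assms(3)] by (auto simp: eventually_at_top_linorder)
  have "u \<le> v" using u v monoD[of F v u] assms(1) by (force simp: continuous_cdf_def)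
  then show ?thesis
    using IVT'[of F u p v] u v continuous_on_subset[OF F(3)] that by auto
qed

text \<open>
  Midpoint log-concavity excludes flat pieces at heights between 0 and 1: if \<open>m\<close> is the right end of
  such a piece starting at \<open>s\<close>, then log-concavity at \<open>m\<close>, the midpoint of \<open>s\<close> and \<open>2 m - s\<close>, extends the
  piece up to \<open>2 m - s\<close>.
\<close>
lemma continuous_cdf_strict:
  assumes F: "continuous_cdf F" and conc: "\<And>s t. F s * F t \<le> F ((s + t) / 2) ^ 2"
    and s: "0 < F s" "F s < 1" "s < t"
  shows "F s < F t"
proof (rule ccontr)
  assume "\<not> F s < F t"
  have mono: "F x \<le> F y" if "x \<le> y" for x y
    using F that by (auto simp: continuous_cdf_def mono_def)
  have top: "(F \<longlongrightarrow> 1) at_top" and cont: "continuous_on UNIV F"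
    using F by (auto simp: continuous_cdf_def)
  define S where "S = {x. F x \<le> F s}"
  have "t \<in> S" using \<open>\<not> F s < F t\<close> by (simp add: S_def)
  obtain v where v: "F s < F v"
    using order_tendstoD(1)[OF top s(2)] by (auto simp: eventually_at_top_linorder)
  have bdd: "bdd_above S"
  proof (rule bdd_aboveI)
    show "x \<le> v" if "x \<in> S" for x
      using mono[of v x] v that by (force simp: S_def)
  qed
  have "closed S"
    unfolding S_def using cont by (intro closed_Collect_le) (auto intro: continuous_on_const)
  define m where "m = Sup S"
  have "m \<in> S"
    unfolding m_def using \<open>t \<in> S\<close> bdd \<open>closed S\<close> by (intro closed_contains_Sup) auto
  have "t \<le> m" unfolding m_def using \<open>t \<in> S\<close> bdd by (intro cSup_upper)
  have "F (2 * m - s) * F s \<le> F m ^ 2" using conc[of "2 * m - s" s] by simp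
  also have "\<dots> \<le> F s ^ 2"
    using \<open>m \<in> S\<close> continuous_cdf_bounds[OF F] by (intro power_mono) (auto simp: S_def)
  finally have "F (2 * m - s) \<le> F s" using s by (simp add: power2_eq_square)
  then have "2 * m - s \<le> m"
    unfolding m_def using bdd by (intro cSup_upper) (auto simp: S_def)
  with \<open>t \<le> m\<close> s show False by simp
qed

text \<open>
  For the distribution functions below, which are strictly increasing between heights 0 and 1, the
  choice is unique for \<open>0 < p < 1\<close>.
\<close>
definition quantile :: "(real \<Rightarrow> real) \<Rightarrow> real \<Rightarrow> real" where
  "quantile F p = (SOME s. F s = p)"

lemma cdf_quantile:
  assumes "continuous_cdf F" "0 < p" "p < 1"
  shows "F (quantile F p) = p"
proof -
  obtain s where "F s = p"
    by (rule continuous_cdf_surj[OF assms])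
  then show ?thesis
    unfolding quantile_def by (rule someI[of "\<lambda>s. F s = p"])
qed

text \<open>
  The information on one-dimensional marginals that the midpoint form of the Brunn--Minkowski
  inequality gives for two convex sets and their midpoint set, when all three have the same volume.
\<close>
locale extremal_cdfs =
  fixes F G H :: "real \<Rightarrow> real"
  assumes F: "continuous_cdf F" and G: "continuous_cdf G" and H: "continuous_cdf H"
    and FF: "\<And>s t. F s * F t \<le> F ((s + t) / 2) ^ 2"
    and GG: "\<And>s t. G s * G t \<le> G ((s + t) / 2) ^ 2"
    and HH: "\<And>s t. H s * H t \<le> H ((s + t) / 2) ^ 2"
    and FG: "\<And>s t. F s * G t \<le> H ((s + t) / 2) ^ 2"
    and FG': "\<And>s t. (1 - F s) * (1 - G t) \<le> (1 - H ((s + t) / 2)) ^ 2"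
begin

lemma swap: "extremal_cdfs G F H"
proof
  show "G s * F t \<le> H ((s + t) / 2) ^ 2" for s t
    using FG[of t s] by (simp add: mult.commute add.commute)
  show "(1 - G s) * (1 - F t) \<le> (1 - H ((s + t) / 2)) ^ 2" for s t
    using FG'[of t s] by (simp add: mult.commute add.commute)
qed (fact F G H FF GG HH)+

text \<open>
  The lower-tail bound gives one inequality and the upper-tail bound the other. This is where the
  equality of the three volumes enters: the tails of each marginal add up to 1.
\<close>
lemma level_midpoint:
  assumes "F s = p" "G t = p"
  shows "H ((s + t) / 2) = p"
proof (rule antisym)
  have H01: "0 \<le> H ((s + t) / 2)" "0 \<le> 1 - H ((s + t) / 2)"
    using continuous_cdf_bounds[OF H, of "(s + t) / 2"] by simp_all
  have "p ^ 2 \<le> H ((s + t) / 2) ^ 2"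
    using FG[of s t] by (simp add: assms power2_eq_square)
  then show "p \<le> H ((s + t) / 2)"
    using H01(1) by (rule power2_le_imp_le)
  have "(1 - p) ^ 2 \<le> (1 - H ((s + t) / 2)) ^ 2"
    using FG'[of s t] by (simp add: assms power2_eq_square)
  then have "1 - p \<le> 1 - H ((s + t) / 2)"
    using H01(2) by (rule power2_le_imp_le)
  then show "H ((s + t) / 2) \<le> p" by simp
qed

text \<open>
  Moving to levels \<open>k * p\<close> and \<open>p / k\<close> preserves the product of the levels, so the midpoint of the new
  quantiles still has at least the mass \<open>p\<close> to its left.
\<close>
lemma quantile_exchange:
  assumes k: "0 < k" and p: "0 < p" "p < 1"
    and "F s = p" "G t = p" "F s' = k * p" "G t' = p / k"
  shows "s + t \<le> s' + t'"
proof (rule ccontr)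
  assume "\<not> ?thesis"
  then have less: "(s' + t') / 2 < (s + t) / 2" by simp
  have "p ^ 2 \<le> H ((s' + t') / 2) ^ 2"
    using FG[of s' t'] assms by (simp add: power2_eq_square)
  then have "p \<le> H ((s' + t') / 2)"
    using continuous_cdf_bounds(1)[OF H] by (rule power2_le_imp_le)
  moreover have "H ((s + t) / 2) = p" using assms by (intro level_midpoint)
  moreover have "H ((s' + t') / 2) \<le> H ((s + t) / 2)"
    using H less by (auto simp: continuous_cdf_def mono_def)
  ultimately have "H ((s' + t') / 2) = p" by simp
  with continuous_cdf_strict[of H, OF H HH _ _ less] p \<open>H ((s + t) / 2) = p\<close> show False by auto
qed

lemma quantile_mono: assumes "0 < p" "p \<le> q" "q < 1" shows "quantile F p \<le> quantile F q"
proof (rule ccontr)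
  assume "\<not> ?thesis"
  then have less: "quantile F q < quantile F p" by simp
  have pq: "F (quantile F p) = p" "F (quantile F q) = q"
    using assms by (simp_all add: cdf_quantile F)
  have "F (quantile F q) < F (quantile F p)"
    by (rule continuous_cdf_strict[of F, OF F FF _ _ less]) (use pq assms in simp_all)
  with pq assms show False by simp
qed

lemma quantile_right_cont:
  assumes "0 < p" "p < 1" "0 < e"
  obtains q where "p < q" "q < 1" "\<And>r. 0 < r \<Longrightarrow> r < q \<Longrightarrow> quantile F r \<le> quantile F p + e"
proof
  let ?s = "quantile F p + e"
  have "F (quantile F p) < F ?s"
    using assms cdf_quantile[OF F assms(1,2)] by (intro continuous_cdf_strict[of F, OF F FF]) auto
  then show "p < min (F ?s) ((1 + p) / 2)" "min (F ?s) ((1 + p) / 2) < 1"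
    using assms cdf_quantile[OF F assms(1,2)] by (auto simp: min_less_iff_disj)
  show "quantile F r \<le> ?s" if "0 < r" "r < min (F ?s) ((1 + p) / 2)" for r
  proof (rule ccontr)
    assume "\<not> ?thesis"
    then have "F ?s \<le> F (quantile F r)" using F by (auto simp: continuous_cdf_def mono_def)
    moreover have "r < 1" using that assms by auto
    ultimately show False using cdf_quantile[OF F, of r] that by auto
  qed
qed

text \<open>
  With \<open>a\<close>, \<open>b\<close> the quantile functions of \<open>F\<close>, \<open>G\<close> and \<open>u n = p * k ^ n\<close>, the exchange lemma at \<open>u (n + 1)\<close>
  bounds \<open>b (u (n + 1)) - b (u n)\<close> by \<open>a (u (n + 2)) - a (u (n + 1))\<close>. Both sides telescope. Since
  \<open>u\<close> runs from \<open>p\<close> to \<open>q\<close>, the sums are \<open>b q - b p\<close> and \<open>a (k * q) - a (k * p)\<close>, and the latter exceeds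
  \<open>a q - a p\<close> by little when \<open>k\<close> is close to 1.
\<close>
lemma quantile_increment:
  assumes "0 < p" "p < q" "q < 1"
  shows "quantile G q - quantile G p \<le> quantile F q - quantile F p"
proof (rule field_le_epsilon)
  fix e :: real assume "0 < e"
  obtain r where r: "q < r" "r < 1" "\<And>u. 0 < u \<Longrightarrow> u < r \<Longrightarrow> quantile F u \<le> quantile F q + e"
    using quantile_right_cont[of q e] assms \<open>0 < e\<close> by auto
  have "(\<lambda>n. root n (q / p)) \<longlonglongrightarrow> 1" using assms by (intro LIMSEQ_root_const) auto
  then have "\<forall>\<^sub>F n in sequentially. root n (q / p) < r / q"
    using r assms by (intro order_tendstoD) auto
  (* Enough steps that the one extra factor k does not leave the interval on which the quantile
     function of F exceeds its value at q by at most e. *)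
  then obtain K where K: "K > 0" "root K (q / p) < r / q"
    unfolding eventually_sequentially by (meson le_Suc_eq order_refl zero_less_Suc)
  define k where "k = root K (q / p)"
  have k: "1 < k" "k ^ K = q / p" "k * q < r"
    using K assms by (auto simp: k_def real_root_gt_1_iff field_simps)
  have pk: "p * k ^ n \<le> k * q" if "n \<le> Suc K" for n
  proof -
    have "k ^ n \<le> k ^ Suc K" using k that by (intro power_increasing) auto
    then have "p * k ^ n \<le> p * k ^ Suc K" using assms by (intro mult_left_mono) auto
    also have "\<dots> = k * q" using k assms by simp
    finally show ?thesis .
  qed
  have pos: "0 < p * k ^ n" for n using k assms by auto
  let ?a = "\<lambda>n. quantile F (p * k ^ n)" and ?b = "\<lambda>n. quantile G (p * k ^ n)"
  have step: "?b (Suc n) - ?b n \<le> ?a (Suc (Suc n)) - ?a (Suc n)" if "n < K" for n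
  proof -
    have lt: "p * k ^ m < 1" if "m \<le> Suc K" for m using pk[OF that] k r by linarith
    have "?a (Suc n) + ?b (Suc n) \<le> ?a (Suc (Suc n)) + ?b n"
    proof (rule quantile_exchange[where k = k and p = "p * k ^ Suc n"])
      have "p * k ^ Suc n < 1" using \<open>n < K\<close> by (intro lt) simp
      then show "F (?a (Suc n)) = p * k ^ Suc n" "G (?b (Suc n)) = p * k ^ Suc n"
        "p * k ^ Suc n < 1" by (simp_all only: cdf_quantile[OF F pos] cdf_quantile[OF G pos])
      have "F (?a (Suc (Suc n))) = p * k ^ Suc (Suc n)"
        using \<open>n < K\<close> by (intro cdf_quantile[OF F pos] lt) simp
      then show "F (?a (Suc (Suc n))) = k * (p * k ^ Suc n)" by simp
      have "G (?b n) = p * k ^ n"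
        using \<open>n < K\<close> by (intro cdf_quantile[OF G pos] lt) simp
      then show "G (?b n) = p * k ^ Suc n / k" using k by simp
    qed (use k pos[of "Suc n"] in auto)
    then show ?thesis by simp
  qed
  have "?b n - ?b 0 \<le> ?a (Suc n) - ?a (Suc 0)" if "n \<le> K" for n
    using that
  proof (induction n)
    case (Suc n)
    then show ?case using step[of n] by simp
  qed simp
  from this[of K] have "quantile G q - quantile G p \<le> quantile F (k * q) - quantile F (k * p)"
    using k assms by (simp add: mult.commute)
  moreover have "quantile F (k * q) \<le> quantile F q + e" using r k assms by (intro r(3)) auto
  moreover have "quantile F p \<le> quantile F (k * p)"
  proof (rule quantile_mono)
    have "k * p \<le> k * q" using k assms by auto
    with k r show "k * p < 1" by linarith
  qed (use k assms in auto)
  ultimately show "quantile G q - quantile G p \<le> quantile F q - quantile F p + e" by linarith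
qed

end

text \<open>
  The comparison of increments holds in both directions, so the quantile functions of \<open>F\<close> and \<open>G\<close>
  differ by a constant.
\<close>
lemma (in extremal_cdfs) translate:
  obtains c where "\<And>s. F s = G (s - c)"
proof -
  define c where "c = quantile F (1/2) - quantile G (1/2)"
  have same: "quantile F q - quantile F p = quantile G q - quantile G p" if "0 < p" "p < q" "q < 1" for p q
    using quantile_increment[OF that] extremal_cdfs.quantile_increment[OF swap that] by linarith
  have c: "quantile F p - quantile G p = c" if "0 < p" "p < 1" for p
  proof (cases p "1/2 :: real" rule: linorder_cases)
    case less
    then show ?thesis using same[of p "1/2"] that by (simp add: c_def)
  next
    case equal
    then show ?thesis by (simp only: c_def)
  next
    case greater
    then show ?thesis using same[of "1/2" p] that by (simp add: c_def)
  qed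
  have F_eq: "F (s + c) = p" if "G s = p" "0 < p" "p < 1" for s p
  proof -
    have "s = quantile G p"
      using continuous_cdf_strict[of G, OF G GG, of s "quantile G p"] continuous_cdf_strict[of G, OF G GG, of "quantile G p" s]
        cdf_quantile[OF G that(2,3)] that by (cases s "quantile G p" rule: linorder_cases) auto
    then show ?thesis using c[OF that(2,3)] cdf_quantile[OF F that(2,3)] by (simp add: algebra_simps)
  qed
  have mono: "F x \<le> F y" "G x \<le> G y" if "x \<le> y" for x y
    using F G that by (auto simp: continuous_cdf_def mono_def)
  have "F s = G (s - c)" for s
  proof (rule ccontr)
    assume "F s \<noteq> G (s - c)"
    then have "min (F s) (G (s - c)) < max (F s) (G (s - c))" by linarith
    (* A level strictly between the two values is attained by F at a point and by G at that point
       shifted by c; monotonicity forbids both values to lie on different sides of it. *)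
    from dense[OF this] obtain p where p: "min (F s) (G (s - c)) < p" "p < max (F s) (G (s - c))"
      by blast
    have p01: "0 < p" "p < 1"
      using p continuous_cdf_bounds[OF F, of s] continuous_cdf_bounds[OF G, of "s - c"]
      by (auto simp: min_def max_def split: if_splits)
    have "F (quantile G p + c) = p" "G (quantile G p) = p"
      using cdf_quantile[OF G p01] F_eq p01 by auto
    with mono[of s "quantile G p + c"] mono[of "quantile G p + c" s] mono[of "s - c" "quantile G p"]
      mono[of "quantile G p" "s - c"] p
    show False by (cases "s \<le> quantile G p + c") (auto simp: min_def max_def split: if_splits)
  qed
  then show ?thesis by (rule that)
qed

section \<open>Bodies whose half difference body has the same volume\<close>

text \<open>
  The difference body scaled to make its volume comparable with that of \<open>A\<close>; it is the midpoint set of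
  \<open>A\<close> and \<open>-A\<close>.
\<close>
abbreviation halfdiff :: "'a::real_vector set \<Rightarrow> 'a set" where
  "halfdiff A \<equiv> (\<lambda>(x, y). (1/2) *\<^sub>R (x - y)) ` (A \<times> A)"

lemma brunn_minkowski_midpoint_measure:
  fixes A B C :: "'a::euclidean_space set"
  assumes "A \<in> sets borel" "B \<in> sets borel" "C \<in> sets borel" "emeasure lborel C \<noteq> \<infinity>"
    and "\<And>x y. x \<in> A \<Longrightarrow> y \<in> B \<Longrightarrow> (1/2) *\<^sub>R (x + y) \<in> C"
  shows "measure lborel A * measure lborel B \<le> measure lborel C ^ 2"
proof -
  have "enn2real (emeasure lborel A * emeasure lborel B) \<le> enn2real (emeasure lborel C ^ 2)"
    using brunn_minkowski_midpoint[of A B C] assms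
    by (intro enn2real_mono) (auto simp: top.not_eq_extremum[symmetric] power_eq_top_ennreal)
  then show ?thesis
    by (simp add: measure_def enn2real_mult power2_eq_square)
qed

definition marginal_cdf :: "'a::euclidean_space set \<Rightarrow> 'a \<Rightarrow> real \<Rightarrow> real" where
  "marginal_cdf A \<theta> s = measure (uniform_measure lborel A) {x. \<theta> \<bullet> x \<le> s}"

lemma marginal_cdf_continuous:
  fixes A :: "'a::euclidean_space set"
  assumes A: "emeasure lborel A \<noteq> 0" "emeasure lborel A \<noteq> \<infinity>" and "\<theta> \<noteq> 0"
  shows "continuous_cdf (marginal_cdf A \<theta>)"
proof -
  interpret prob_space "uniform_measure lborel A"
    using A by (rule prob_space_uniform_measure)
  let ?D = "distr (uniform_measure lborel A) borel (\<lambda>x. \<theta> \<bullet> x)"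
  interpret D: real_distribution ?D by (rule real_distribution_distr) simp
  have eq: "marginal_cdf A \<theta> = cdf ?D"
    by (auto simp: marginal_cdf_def cdf_def fun_eq_iff measure_distr vimage_def)
  have "measure ?D {s} = 0" for s
  proof -
    have "{x. \<theta> \<bullet> x = s} \<in> null_sets lebesgue"
      using negligible_hyperplane[of \<theta> s] \<open>\<theta> \<noteq> 0\<close> by (simp add: negligible_iff_null_sets)
    moreover have b: "{x. \<theta> \<bullet> x = s} \<in> sets borel" by simp
    ultimately have "emeasure lborel {x. \<theta> \<bullet> x = s} = 0"
      by (auto simp: null_sets_def)
    then have "emeasure lborel (A \<inter> {x. \<theta> \<bullet> x = s}) = 0"
      using emeasure_mono[of "A \<inter> {x. \<theta> \<bullet> x = s}" "{x. \<theta> \<bullet> x = s}" lborel] b by simp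
    then show ?thesis
      using A b by (simp add: measure_distr vimage_def measure_def[of lborel])
  qed
  then have "continuous_on UNIV (cdf ?D)"
    by (simp add: continuous_on_eq_continuous_at D.isCont_cdf)
  then show ?thesis
    unfolding continuous_cdf_def eq
    using D.cdf_nondecreasing D.cdf_lim_at_bot D.cdf_lim_at_top_prob by (auto simp: mono_def)
qed

text \<open>
  When the three sets have the same volume, normalising preserves the inequality for their parts
  in \<open>S\<close>, \<open>T\<close> and \<open>R\<close>.
\<close>
lemma uniform_measure_midpoint:
  fixes A B C S T R :: "'a::euclidean_space set"
  assumes "A \<in> sets borel" "B \<in> sets borel" "C \<in> sets borel"
    and [measurable]: "S \<in> sets borel" "T \<in> sets borel" "R \<in> sets borel"
    and vol: "emeasure lborel C \<noteq> 0" "emeasure lborel C \<noteq> \<infinity>"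
      "emeasure lborel A = emeasure lborel C" "emeasure lborel B = emeasure lborel C"
    and mid: "\<And>x y. x \<in> A \<Longrightarrow> y \<in> B \<Longrightarrow> (1/2) *\<^sub>R (x + y) \<in> C"
    and mid': "\<And>x y. x \<in> S \<Longrightarrow> y \<in> T \<Longrightarrow> (1/2) *\<^sub>R (x + y) \<in> R"
  shows "measure (uniform_measure lborel A) S * measure (uniform_measure lborel B) T
    \<le> measure (uniform_measure lborel C) R ^ 2"
proof -
  have "emeasure lborel (C \<inter> R) \<le> emeasure lborel C"
    using assms(3) by (intro emeasure_mono) auto
  then have "emeasure lborel (C \<inter> R) \<noteq> \<infinity>" using vol(2) by (auto simp: top_unique)
  then have le: "measure lborel (A \<inter> S) * measure lborel (B \<inter> T) \<le> measure lborel (C \<inter> R) ^ 2"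
    using assms by (intro brunn_minkowski_midpoint_measure) auto
  have v: "measure lborel A = measure lborel C" "measure lborel B = measure lborel C"
    using vol by (simp_all add: measure_def)
  have "measure (uniform_measure lborel A) S * measure (uniform_measure lborel B) T =
      (measure lborel (A \<inter> S) * measure lborel (B \<inter> T)) / measure lborel C ^ 2"
    using vol by (simp add: v power2_eq_square)
  also have "\<dots> \<le> measure lborel (C \<inter> R) ^ 2 / measure lborel C ^ 2"
    by (intro divide_right_mono le) auto
  also have "\<dots> = measure (uniform_measure lborel C) R ^ 2"
    using vol by (simp add: power_divide)
  finally show ?thesis .
qed

lemma marginal_cdf_midpoint:
  fixes A B C :: "'a::euclidean_space set"
  assumes "A \<in> sets borel" "B \<in> sets borel" "C \<in> sets borel"
    and vol: "emeasure lborel C \<noteq> 0" "emeasure lborel C \<noteq> \<infinity>"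
      "emeasure lborel A = emeasure lborel C" "emeasure lborel B = emeasure lborel C"
    and mid: "\<And>x y. x \<in> A \<Longrightarrow> y \<in> B \<Longrightarrow> (1/2) *\<^sub>R (x + y) \<in> C"
  shows "marginal_cdf A \<theta> s * marginal_cdf B \<theta> t \<le> marginal_cdf C \<theta> ((s + t) / 2) ^ 2"
    and "(1 - marginal_cdf A \<theta> s) * (1 - marginal_cdf B \<theta> t) \<le> (1 - marginal_cdf C \<theta> ((s + t) / 2)) ^ 2"
proof -
  show "marginal_cdf A \<theta> s * marginal_cdf B \<theta> t \<le> marginal_cdf C \<theta> ((s + t) / 2) ^ 2"
    unfolding marginal_cdf_def using assms
    by (intro uniform_measure_midpoint) (auto simp: inner_add_right)
  have compl: "1 - marginal_cdf X \<theta> u = measure (uniform_measure lborel X) {x. u < \<theta> \<bullet> x}"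
    if "emeasure lborel X = emeasure lborel C" for X :: "'a set" and u
  proof -
    interpret prob_space "uniform_measure lborel X"
      using vol that by (intro prob_space_uniform_measure) auto
    have "{x. u < \<theta> \<bullet> x} = space (uniform_measure lborel X) - {x. \<theta> \<bullet> x \<le> u}" by auto
    then show ?thesis
      unfolding marginal_cdf_def by (subst prob_compl[symmetric]) auto
  qed
  show "(1 - marginal_cdf A \<theta> s) * (1 - marginal_cdf B \<theta> t) \<le> (1 - marginal_cdf C \<theta> ((s + t) / 2)) ^ 2"
    unfolding compl[OF vol(3)] compl[OF vol(4)] compl[OF refl] using assms
    by (intro uniform_measure_midpoint) (auto simp: inner_add_right)
qed

lemma emeasure_lborel_uminus:
  fixes S :: "'a::euclidean_space set"
  assumes "S \<in> sets borel"
  shows "emeasure lborel (uminus ` S) = emeasure lborel S"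
proof -
  have "uminus ` S = uminus -` S \<inter> space borel" by force
  also have "\<dots> \<in> sets borel" using assms by (intro measurable_sets[of uminus borel borel]) auto
  finally have "emeasure lborel (uminus ` S) = emeasure lebesgue ((\<lambda>x. (-1) *\<^sub>R x + 0) ` S)" by simp
  also have "\<dots> = emeasure lebesgue S" by (subst emeasure_lebesgue_affine) simp
  finally show ?thesis using assms by simp
qed

lemma compact_emeasure_lborel_finite: "compact A \<Longrightarrow> emeasure lborel A \<noteq> \<infinity>"
  for A :: "'a::euclidean_space set"
  using emeasure_bounded_finite[OF compact_imp_bounded] by (auto simp: less_top)

lemma compact_halfdiff:
  fixes A :: "'a::euclidean_space set"
  assumes "compact A" shows "compact (halfdiff A)"
proof (rule compact_continuous_image)
  show "continuous_on (A \<times> A) (\<lambda>(x, y). (1/2) *\<^sub>R (x - y))"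
    unfolding split_def by (intro continuous_intros)
  show "compact (A \<times> A)" using assms assms by (rule compact_Times)
qed

lemma halfdiff_volume:
  fixes A :: "'a::euclidean_space set"
  assumes "compact A"
  shows "emeasure lborel A \<le> emeasure lborel (halfdiff A)"
proof -
  have [simp]: "A \<in> sets borel" "halfdiff A \<in> sets borel" "uminus ` A \<in> sets borel"
    using assms compact_halfdiff[OF assms] by (auto intro!: borel_compact compact_negations)
  have fin: "emeasure lborel A \<noteq> \<infinity>" "emeasure lborel (halfdiff A) \<noteq> \<infinity>"
    using assms compact_halfdiff[OF assms] by (simp_all only: compact_emeasure_lborel_finite not_False_eq_True)
  have mU: "measure lborel (uminus ` A) = measure lborel A"
    by (simp add: measure_def emeasure_lborel_uminus)
  have "measure lborel A * measure lborel (uminus ` A) \<le> measure lborel (halfdiff A) ^ 2"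
    using fin by (intro brunn_minkowski_midpoint_measure) auto
  then have "measure lborel A ^ 2 \<le> measure lborel (halfdiff A) ^ 2"
    using mU by (simp only: power2_eq_square)
  then have "measure lborel A \<le> measure lborel (halfdiff A)"
    by (rule power2_le_imp_le) simp
  then show ?thesis
    using fin by (simp add: emeasure_eq_ennreal_measure ennreal_leI)
qed

text \<open>
  The marginals of \<open>A\<close>, \<open>-A\<close> and their midpoint set are extremal, so the marginal of \<open>A\<close> is a translate of
  that of \<open>-A\<close>, which is the reflected marginal of \<open>A\<close>.
\<close>
lemma marginal_symmetric:
  fixes A :: "'a::euclidean_space set"
  assumes A: "compact A" "convex A" "emeasure lborel A \<noteq> 0"
    and eq: "emeasure lborel (halfdiff A) = emeasure lborel A" and "\<theta> \<noteq> 0"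
  obtains c where "distr (uniform_measure lborel A) borel (\<lambda>x. \<theta> \<bullet> x)
    = distr (uniform_measure lborel A) borel (\<lambda>x. c - \<theta> \<bullet> x)"
proof -
  let ?B = "uminus ` A" and ?D = "halfdiff A"
  have bor[simp]: "A \<in> sets borel" "?D \<in> sets borel" "?B \<in> sets borel"
    using A(1) compact_halfdiff[OF A(1)] by (auto intro!: borel_compact compact_negations)
  have fin: "emeasure lborel A \<noteq> \<infinity>" by (rule compact_emeasure_lborel_finite) fact
  have vB: "emeasure lborel ?B = emeasure lborel A" by (rule emeasure_lborel_uminus) simp
  have cA: "(1/2) *\<^sub>R (x + y) \<in> A" if "x \<in> A" "y \<in> A" for x y
    using convexD[OF A(2) that, of "1/2" "1/2"] by (simp add: scaleR_add_right)
  have cB: "(1/2) *\<^sub>R (x + y) \<in> ?B" if xy: "x \<in> ?B" "y \<in> ?B" for x y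
  proof -
    obtain u v where "x = - u" "y = - v" "u \<in> A" "v \<in> A" using xy by auto
    then show ?thesis using cA[of u v] by (intro image_eqI[of _ _ "(1/2) *\<^sub>R (u + v)"])
      (auto simp: algebra_simps)
  qed
  have cD: "(1/2) *\<^sub>R (x + y) \<in> ?D" if xy: "x \<in> ?D" "y \<in> ?D" for x y
  proof -
    obtain u v u' v' where uv: "x = (1/2) *\<^sub>R (u - v)" "y = (1/2) *\<^sub>R (u' - v')"
      and A': "u \<in> A" "v \<in> A" "u' \<in> A" "v' \<in> A" using xy by auto
    have "(1/2) *\<^sub>R (x + y) = (1/2) *\<^sub>R ((1/2) *\<^sub>R (u + u') - (1/2) *\<^sub>R (v + v'))"
      unfolding uv by (simp add: algebra_simps)
    then show ?thesis using cA[of u u'] cA[of v v'] A'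
      by (intro image_eqI[of _ _ "((1/2) *\<^sub>R (u + u'), (1/2) *\<^sub>R (v + v'))"]) auto
  qed
  interpret extremal_cdfs "marginal_cdf A \<theta>" "marginal_cdf ?B \<theta>" "marginal_cdf ?D \<theta>"
  proof
    show "continuous_cdf (marginal_cdf A \<theta>)" "continuous_cdf (marginal_cdf ?B \<theta>)"
      "continuous_cdf (marginal_cdf ?D \<theta>)"
      using A(3) fin \<open>\<theta> \<noteq> 0\<close> by (auto intro!: marginal_cdf_continuous simp: vB eq)
    fix s t
    show "marginal_cdf A \<theta> s * marginal_cdf A \<theta> t \<le> marginal_cdf A \<theta> ((s + t) / 2) ^ 2"
      using A(3) fin cA by (intro marginal_cdf_midpoint(1)) auto
    show "marginal_cdf ?B \<theta> s * marginal_cdf ?B \<theta> t \<le> marginal_cdf ?B \<theta> ((s + t) / 2) ^ 2"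
      using A(3) fin by (intro marginal_cdf_midpoint(1) cB) (auto simp: vB)
    show "marginal_cdf ?D \<theta> s * marginal_cdf ?D \<theta> t \<le> marginal_cdf ?D \<theta> ((s + t) / 2) ^ 2"
      using A(3) fin by (intro marginal_cdf_midpoint(1) cD) (auto simp: eq)
    show "marginal_cdf A \<theta> s * marginal_cdf ?B \<theta> t \<le> marginal_cdf ?D \<theta> ((s + t) / 2) ^ 2"
      "(1 - marginal_cdf A \<theta> s) * (1 - marginal_cdf ?B \<theta> t) \<le> (1 - marginal_cdf ?D \<theta> ((s + t) / 2)) ^ 2"
      using A(3) fin by (intro marginal_cdf_midpoint; auto simp: eq vB)+
  qed
  obtain c where c: "\<And>s. marginal_cdf A \<theta> s = marginal_cdf ?B \<theta> (s - c)"
    by (rule translate) blast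
  interpret prob_space "uniform_measure lborel A"
    using A(3) fin by (rule prob_space_uniform_measure)
  have reflect: "marginal_cdf ?B \<theta> t = measure (uniform_measure lborel A) {x. - t \<le> \<theta> \<bullet> x}" for t
  proof -
    have "?B \<inter> {x. \<theta> \<bullet> x \<le> t} = uminus ` (A \<inter> {x. - t \<le> \<theta> \<bullet> x})"
      by (force simp: image_iff)
    moreover have "A \<inter> {x. - t \<le> \<theta> \<bullet> x} \<in> sets borel" by (intro sets.Int bor(1)) simp
    ultimately have "emeasure lborel (?B \<inter> {x. \<theta> \<bullet> x \<le> t}) = emeasure lborel (A \<inter> {x. - t \<le> \<theta> \<bullet> x})"
      using emeasure_lborel_uminus[of "A \<inter> {x. - t \<le> \<theta> \<bullet> x}"] by (simp only:)
    then have "measure lborel (?B \<inter> {x. \<theta> \<bullet> x \<le> t}) = measure lborel (A \<inter> {x. - t \<le> \<theta> \<bullet> x})"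
      by (simp only: measure_def)
    moreover have "measure lborel ?B = measure lborel A"
      using vB by (simp only: measure_def)
    ultimately show ?thesis
      unfolding marginal_cdf_def using A(3) fin
      by (subst (1 2) measure_uniform_measure) (simp_all add: vB)
  qed
  have "distr (uniform_measure lborel A) borel (\<lambda>x. \<theta> \<bullet> x)
    = distr (uniform_measure lborel A) borel (\<lambda>x. c - \<theta> \<bullet> x)" (is "?M = ?N")
  proof (rule cdf_unique)
    show "real_distribution ?M" "real_distribution ?N"
      by (rule real_distribution_distr, simp)+
    show "cdf ?M = cdf ?N"
    proof
      fix s
      have "cdf ?M s = marginal_cdf A \<theta> s"
        by (simp add: cdf_def measure_distr vimage_def marginal_cdf_def)
      also have "\<dots> = measure (uniform_measure lborel A) {x. - (s - c) \<le> \<theta> \<bullet> x}"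
        by (simp only: c reflect)
      also have "{x. - (s - c) \<le> \<theta> \<bullet> x} = {x. c - \<theta> \<bullet> x \<le> s}" by auto
      also have "measure (uniform_measure lborel A) \<dots> = cdf ?N s"
        by (simp add: cdf_def measure_distr vimage_def)
      finally show "cdf ?M s = cdf ?N s" .
    qed
  qed
  then show ?thesis by (rule that)
qed

text \<open>
  The centre \<open>g\<close> is the centroid. If \<open>2 g - x\<close> were not in \<open>A\<close>, a separating hyperplane would cut off a
  half-space that misses \<open>A\<close> but whose mirror image with respect to \<open>g\<close> contains a neighbourhood of
  \<open>x\<close>, hence a part of \<open>A\<close> of positive volume; the marginal in the normal direction would not be
  symmetric.
\<close>
lemma halfdiff_volume_eq_imp_symmetric:
  fixes A :: "'a::euclidean_space set"
  assumes A: "compact A" "convex A" "emeasure lborel A \<noteq> 0"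
    and eq: "emeasure lborel (halfdiff A) = emeasure lborel A"
  obtains g where "\<And>x. x \<in> A \<Longrightarrow> 2 *\<^sub>R g - x \<in> A"
proof
  let ?U = "uniform_measure lborel A"
  have bor[measurable, simp]: "A \<in> sets borel" using A(1) by (rule borel_compact)
  have fin: "emeasure lborel A \<noteq> \<infinity>" by (rule compact_emeasure_lborel_finite) fact
  interpret prob_space ?U
    using A(3) fin by (rule prob_space_uniform_measure)
  have AE: "AE x in ?U. x \<in> A" by (rule AE_uniform_measureI) auto
  obtain R where R: "\<And>x. x \<in> A \<Longrightarrow> norm x \<le> R"
    using compact_imp_bounded[OF A(1)] by (auto simp: bounded_iff)
  have int: "integrable ?U (\<lambda>x. x)"
    by (rule integrable_const_bound[where B = R]) (use AE R in \<open>auto elim: eventually_mono\<close>)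
  define g where "g = (\<integral>x. x \<partial>?U)"
  fix x assume x: "x \<in> A"
  show "2 *\<^sub>R (\<integral>x. x \<partial>?U) - x \<in> A"
    unfolding g_def[symmetric]
  proof (rule ccontr)
    assume "2 *\<^sub>R g - x \<notin> A"
    then obtain a b where ab: "a \<bullet> (2 *\<^sub>R g - x) < b" "\<And>y. y \<in> A \<Longrightarrow> b < a \<bullet> y"
      using separating_hyperplane_closed_point[OF A(2) compact_imp_closed[OF A(1)]] by blast
    have "a \<noteq> 0" using ab(1) ab(2)[OF x] by auto
    obtain c where c: "distr ?U borel (\<lambda>x. a \<bullet> x) = distr ?U borel (\<lambda>x. c - a \<bullet> x)"
      using marginal_symmetric[OF A eq \<open>a \<noteq> 0\<close>] by blast
    have "(\<integral>t. t \<partial>distr ?U borel (\<lambda>x. a \<bullet> x)) = (\<integral>t. t \<partial>distr ?U borel (\<lambda>x. c - a \<bullet> x))"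
      by (simp only: c)
    (* Taking means identifies the centre of symmetry of the marginal as that of the centroid. *)
    then have "a \<bullet> g = c - a \<bullet> g"
      using \<open>a \<noteq> 0\<close> int prob_space by (simp add: integral_distr g_def)
    then have cg: "c - b < a \<bullet> x" using ab(1) by (simp add: inner_diff_right)
    let ?H = "{y. c - b < a \<bullet> y}"
    have "measure ?U ?H = measure (distr ?U borel (\<lambda>x. a \<bullet> x)) {c - b<..}"
      by (simp add: measure_distr vimage_def)
    also have "\<dots> = measure ?U {y. a \<bullet> y < b}"
      unfolding c by (simp add: measure_distr vimage_def)
    also have "\<dots> = 0"
    proof -
      have "A \<inter> {y. a \<bullet> y < b} = {}" using ab(2) by force
      then show ?thesis using A(3) fin by simp
    qed
    finally have "measure ?U ?H = 0" .
    moreover have "measure lborel A \<noteq> 0"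
      using A(3) fin by (simp add: measure_def enn2real_eq_0_iff)
    ultimately have "measure lborel (A \<inter> ?H) = 0"
      using A(3) fin by simp
    moreover have "emeasure lborel (A \<inter> ?H) \<le> emeasure lborel A" by (intro emeasure_mono) auto
    ultimately have zero: "emeasure lborel (A \<inter> ?H) = 0"
      using fin by (auto simp: measure_def enn2real_eq_0_iff top_unique)
    have "interior A \<noteq> {}"
      using A(2,3) negligible_convex_interior[of A] bor by (simp add: negligible_iff_emeasure0)
    then have "x \<in> closure (interior A)"
      using convex_closure_interior[OF A(2)] x closure_subset by auto
    moreover have "open ?H" by (rule open_halfspace_gt)
    ultimately have "interior A \<inter> ?H \<noteq> {}"
      using cg by (auto simp: closure_iff_nhds_not_empty)
    moreover have "open (interior A \<inter> ?H)" using \<open>open ?H\<close> by (intro open_Int) auto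
    ultimately have "\<not> negligible (interior A \<inter> ?H)" by (auto dest: open_not_negligible)
    moreover have "negligible (A \<inter> ?H)" using zero by (simp add: negligible_iff_emeasure0)
    ultimately show False
      using negligible_subset[of "A \<inter> ?H" "interior A \<inter> ?H"] interior_subset[of A] by blast
  qed
qed

section \<open>Slices by symmetric convex sets\<close>

lemma convex_symmetric_diff:
  assumes "convex L" "\<And>x. x \<in> L \<Longrightarrow> - x \<in> L" "2 *\<^sub>R x \<in> L" "2 *\<^sub>R y \<in> L"
  shows "x - y \<in> L"
proof -
  have "(1/2) *\<^sub>R (2 *\<^sub>R x) + (1/2) *\<^sub>R (- (2 *\<^sub>R y)) \<in> L"
    using assms by (intro convexD[of L]) auto
  then show ?thesis by simp
qed

lemma closure_symmetric:
  fixes L :: "'a::real_normed_vector set"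
  assumes "\<And>x. x \<in> L \<Longrightarrow> - x \<in> L" "x \<in> closure L"
  shows "- x \<in> closure L"
proof -
  have "uminus ` closure L \<subseteq> closure L"
    using assms(1) closure_subset[of L]
    by (intro image_closure_subset) (auto intro!: continuous_intros)
  then show ?thesis using assms(2) by auto
qed

text \<open>
  The boundary of a convex set is a null set, so slices may be taken with closed sets.
\<close>
lemma emeasure_Int_closure_convex:
  fixes L X :: "'a::euclidean_space set"
  assumes "convex L" "X \<in> sets lebesgue"
  shows "emeasure lebesgue (X \<inter> closure L) = emeasure lebesgue (X \<inter> L)"
proof -
  have L: "L \<in> sets lebesgue" by (rule convex_imp_sets_lebesgue) fact
  have "X \<inter> closure L - X \<inter> L \<subseteq> frontier L"
    using interior_subset[of L] by (auto simp: frontier_def)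
  then have "negligible (X \<inter> closure L - X \<inter> L)"
    using negligible_convex_frontier[OF assms(1)] negligible_subset by blast
  then have null: "X \<inter> closure L - X \<inter> L \<in> null_sets lebesgue"
    by (simp add: negligible_iff_null_sets)
  have "X \<inter> closure L = X \<inter> L \<union> (X \<inter> closure L - X \<inter> L)" using closure_subset[of L] by auto
  then show ?thesis
    using emeasure_Un_null_set[OF _ null, of "X \<inter> L"] L assms(2) by (metis sets.Int)
qed

text \<open>
  The set \<open>K \<inter> (1/2) closure L\<close>. The closure makes it compact for compact \<open>K\<close>, and for \<open>L = {\<phi> > 0}\<close>
  turns it into the intersection of \<open>K\<close> with half the support of \<open>\<phi>\<close>.
\<close>
definition half_slice :: "'a::real_normed_vector set \<Rightarrow> 'a set \<Rightarrow> 'a set" where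
  "half_slice K L = {x \<in> K. 2 *\<^sub>R x \<in> closure L}"

lemma compact_half_slice: "compact K \<Longrightarrow> compact (half_slice K L)"
  for K :: "'a::euclidean_space set"
proof -
  assume "compact K"
  moreover have "closed ((\<lambda>x::'a. 2 *\<^sub>R x) -` closure L)"
    by (intro closed_vimage continuous_intros) auto
  moreover have "half_slice K L = K \<inter> (\<lambda>x. 2 *\<^sub>R x) -` closure L" by (auto simp: half_slice_def)
  ultimately show ?thesis by (simp add: compact_Int_closed)
qed

lemma convex_half_slice: "convex K \<Longrightarrow> convex L \<Longrightarrow> convex (half_slice K L)"
proof -
  assume "convex K" "convex L"
  moreover have "half_slice K L = K \<inter> (\<lambda>x. 2 *\<^sub>R x) -` closure L" by (auto simp: half_slice_def)
  moreover have "convex ((\<lambda>x. 2 *\<^sub>R x) -` closure L)"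
    using \<open>convex L\<close> by (intro convex_linear_vimage convex_closure) (auto simp: linear_iff algebra_simps)
  ultimately show ?thesis by (simp add: convex_Int)
qed

lemma compact_difference_body:
  fixes K :: "'a::euclidean_space set"
  assumes "compact K" shows "compact (difference_body K)"
proof -
  have "difference_body K = (\<lambda>(x, y). x - y) ` (K \<times> K)"
    by (auto simp: difference_body_def image_iff)
  moreover have "compact \<dots>"
  proof (rule compact_continuous_image)
    show "continuous_on (K \<times> K) (\<lambda>(x, y). x - y)"
      unfolding split_def by (intro continuous_intros)
    show "compact (K \<times> K)" using assms assms by (rule compact_Times)
  qed
  ultimately show ?thesis by simp
qed

lemma emeasure_lebesgue_double:
  fixes S :: "'a::euclidean_space set"
  shows "emeasure lebesgue ((*\<^sub>R) 2 ` S) = 2 ^ DIM('a) * emeasure lebesgue S"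
  using emeasure_lebesgue_affine[of 2 0 S] by (simp add: ennreal_power[symmetric])

text \<open>
  Doubling the half slice gives exactly the slice of \<open>2 K\<close>. Doubling its half difference body stays in
  the slice of the difference body: if \<open>2 x\<close> and \<open>2 y\<close> lie in a symmetric convex set, then so does
  \<open>x - y\<close>, the midpoint of \<open>2 x\<close> and \<open>-2 y\<close>.
\<close>
lemma slice_volumes:
  fixes K L :: "'a::euclidean_space set"
  assumes K: "compact K" and L: "convex L" "\<And>x. x \<in> L \<Longrightarrow> - x \<in> L"
  shows "emeasure lebesgue ((*\<^sub>R) 2 ` K \<inter> L) = 2 ^ DIM('a) * emeasure lborel (half_slice K L)"
    and "2 ^ DIM('a) * emeasure lborel (halfdiff (half_slice K L)) \<le> emeasure lebesgue (difference_body K \<inter> L)"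
proof -
  have sK: "(*\<^sub>R) 2 ` K \<in> sets lebesgue" "difference_body K \<in> sets lebesgue"
    using compact_scaling[OF K, of 2] compact_difference_body[OF K] by (simp_all add: borel_compact)
  have bc: "half_slice K L \<in> sets borel" "halfdiff (half_slice K L) \<in> sets borel"
    using compact_half_slice[OF K] compact_halfdiff[OF compact_half_slice[OF K]] by (simp_all add: borel_compact)
  have "(*\<^sub>R) 2 ` K \<inter> closure L = (*\<^sub>R) 2 ` half_slice K L" by (auto simp: half_slice_def)
  then show "emeasure lebesgue ((*\<^sub>R) 2 ` K \<inter> L) = 2 ^ DIM('a) * emeasure lborel (half_slice K L)"
    using emeasure_Int_closure_convex[OF L(1) sK(1)] bc by (simp add: emeasure_lebesgue_double)
  have "(*\<^sub>R) 2 ` halfdiff (half_slice K L) \<subseteq> difference_body K \<inter> closure L"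
  proof
    fix z assume "z \<in> (*\<^sub>R) 2 ` halfdiff (half_slice K L)"
    then obtain x y where xy: "x \<in> half_slice K L" "y \<in> half_slice K L" and z: "z = x - y" by auto
    have "x - y \<in> closure L"
      using xy L by (intro convex_symmetric_diff closure_symmetric convex_closure) (auto simp: half_slice_def)
    then show "z \<in> difference_body K \<inter> closure L"
      using xy by (auto simp: z difference_body_def half_slice_def)
  qed
  then have "emeasure lebesgue ((*\<^sub>R) 2 ` halfdiff (half_slice K L)) \<le> emeasure lebesgue (difference_body K \<inter> closure L)"
    using sK(2) by (intro emeasure_mono sets.Int) auto
  then show "2 ^ DIM('a) * emeasure lborel (halfdiff (half_slice K L)) \<le> emeasure lebesgue (difference_body K \<inter> L)"
    using bc by (simp add: emeasure_lebesgue_double emeasure_Int_closure_convex[OF L(1) sK(2)])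
qed

lemma slice_inequality:
  fixes K L :: "'a::euclidean_space set"
  assumes K: "compact K" and L: "convex L" "\<And>x. x \<in> L \<Longrightarrow> - x \<in> L"
  shows "emeasure lebesgue ((*\<^sub>R) 2 ` K \<inter> L) \<le> emeasure lebesgue (difference_body K \<inter> L)"
proof -
  have "2 ^ DIM('a) * emeasure lborel (half_slice K L) \<le> 2 ^ DIM('a) * emeasure lborel (halfdiff (half_slice K L))"
    by (intro mult_left_mono halfdiff_volume compact_half_slice K) simp
  also note slice_volumes(2)[OF assms]
  finally show ?thesis by (simp add: slice_volumes(1)[OF assms])
qed

lemma slice_equality:
  fixes K L :: "'a::euclidean_space set"
  assumes K: "compact K" "convex K" and L: "convex L" "\<And>x. x \<in> L \<Longrightarrow> - x \<in> L"
    and eq: "emeasure lebesgue (difference_body K \<inter> L) = emeasure lebesgue ((*\<^sub>R) 2 ` K \<inter> L)"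
    and pos: "emeasure lebesgue (difference_body K \<inter> L) \<noteq> 0"
  obtains g where "\<And>x. x \<in> half_slice K L \<Longrightarrow> 2 *\<^sub>R g - x \<in> half_slice K L"
proof -
  note vol = slice_volumes[OF K(1) L]
  have two: "(2::ennreal) ^ DIM('a) = ennreal (2 ^ DIM('a))"
    by (simp add: ennreal_power[symmetric])
  have "2 ^ DIM('a) * emeasure lborel (halfdiff (half_slice K L)) \<le> 2 ^ DIM('a) * emeasure lborel (half_slice K L)"
    using vol eq by simp
  then have "emeasure lborel (halfdiff (half_slice K L)) \<le> emeasure lborel (half_slice K L)"
    unfolding two by (subst (asm) ennreal_mult_le_mult_iff) auto
  then have "emeasure lborel (halfdiff (half_slice K L)) = emeasure lborel (half_slice K L)"
    using halfdiff_volume[OF compact_half_slice[OF K(1)]] by (intro antisym)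
  moreover have "emeasure lborel (half_slice K L) \<noteq> 0"
    using pos eq vol(1) by auto
  ultimately show ?thesis
    using halfdiff_volume_eq_imp_symmetric[OF compact_half_slice[OF K(1)] convex_half_slice[OF K(2) L(1)]] that
    by blast
qed

lemma centrally_symmetricI:
  fixes A :: "'a::real_vector set"
  assumes "\<And>x. x \<in> A \<Longrightarrow> 2 *\<^sub>R g - x \<in> A"
  shows "centrally_symmetric A"
  unfolding centrally_symmetric_def origin_symmetric_def
proof (intro exI[of _ g] equalityI subsetI)
  fix z assume "z \<in> (\<lambda>a. a - g) ` A"
  then obtain a where "a \<in> A" "z = a - g" by auto
  then show "z \<in> uminus ` (\<lambda>a. a - g) ` A"
    using assms[of a] by (auto simp: image_iff scaleR_2 intro!: bexI[of _ "2 *\<^sub>R g - a"])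
next
  fix z assume "z \<in> uminus ` (\<lambda>a. a - g) ` A"
  then obtain a where "a \<in> A" "z = - (a - g)" by auto
  then show "z \<in> (\<lambda>a. a - g) ` A"
    using assms[of a] by (auto simp: image_iff scaleR_2 intro!: bexI[of _ "2 *\<^sub>R g - a"])
qed

lemma difference_body_symmetric:
  assumes "convex K" "origin_symmetric K"
  shows "difference_body K = (*\<^sub>R) 2 ` K"
proof -
  have neg: "- x \<in> K" if "x \<in> K" for x using assms(2) that by (auto simp: origin_symmetric_def)
  show ?thesis
  proof (intro equalityI subsetI)
    fix z assume "z \<in> difference_body K"
    then obtain a b where ab: "a \<in> K" "b \<in> K" "z = a - b" by (auto simp: difference_body_def)
    have "(1/2) *\<^sub>R a + (1/2) *\<^sub>R (- b) \<in> K"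
      using assms(1) ab neg by (intro convexD) auto
    then show "z \<in> (*\<^sub>R) 2 ` K"
      using ab by (intro image_eqI[of _ _ "(1/2) *\<^sub>R a + (1/2) *\<^sub>R (- b)"]) (auto simp: algebra_simps)
  next
    fix z assume "z \<in> (*\<^sub>R) 2 ` K"
    then obtain x where "x \<in> K" "z = x - (- x)" by (auto simp: scaleR_2)
    then show "z \<in> difference_body K" using neg unfolding difference_body_def by blast
  qed
qed

text \<open>
  Both sets are neighbourhoods of the origin.
\<close>
lemma symmetric_slice_nonnull:
  fixes K L :: "'a::euclidean_space set"
  assumes K: "interior K \<noteq> {}" "compact K" and L: "convex L" "\<And>x. x \<in> L \<Longrightarrow> - x \<in> L"
    and nonnull: "\<not> negligible L"
  shows "emeasure lebesgue (difference_body K \<inter> L) \<noteq> 0"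
proof -
  obtain p where p: "p \<in> interior L"
    using nonnull negligible_convex_interior[OF L(1)] by auto
  have "uminus ` L = L" using L(2) by force
  then have "- p \<in> interior L" using p interior_negations[of L] by force
  then have "(1/2) *\<^sub>R p + (1/2) *\<^sub>R (- p) \<in> interior L"
    using p convex_interior[OF L(1)] by (intro convexD) auto
  then have 0: "0 \<in> interior L" by simp
  obtain q where q: "q \<in> interior K" using K by auto
  define U where "U = (\<lambda>x. x + q) -` interior K \<inter> interior L"
  have "open U" unfolding U_def by (intro open_Int open_vimage continuous_intros) auto
  moreover have "0 \<in> U" using 0 q by (simp add: U_def)
  ultimately have "\<not> negligible U" using open_not_negligible by blast
  moreover have "U \<subseteq> difference_body K \<inter> L"
  proof
    fix x assume "x \<in> U"
    then have "x + q \<in> K" "q \<in> K" "x \<in> L" using q interior_subset by (auto simp: U_def)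
    moreover have "x = (x + q) - q" by simp
    ultimately show "x \<in> difference_body K \<inter> L" unfolding difference_body_def by blast
  qed
  ultimately have "\<not> negligible (difference_body K \<inter> L)" using negligible_subset by blast
  moreover have "difference_body K \<inter> L \<in> sets lebesgue"
    using borel_compact[OF compact_difference_body[OF K(2)]] convex_imp_sets_lebesgue[OF L(1)] by auto
  ultimately show ?thesis by (simp add: negligible_iff_emeasure0)
qed

section \<open>Integration over the levels\<close>

lemma sigma_finite_lebesgue: "sigma_finite_measure (lebesgue :: 'a::euclidean_space measure)"
proof
  obtain A :: "'a set set" where "countable A" "A \<subseteq> sets lborel" "\<Union>A = space lborel"
    "\<forall>a\<in>A. emeasure lborel a \<noteq> \<infinity>"
    using lborel.sigma_finite_countable by blast
  then show "\<exists>A::'a set set. countable A \<and> A \<subseteq> sets lebesgue \<and> \<Union>A = space lebesgue \<and>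
      (\<forall>a\<in>A. emeasure lebesgue a \<noteq> \<infinity>)"
    by (intro exI[of _ A]) auto
qed

lemma density_measure_layer_cake:
  fixes \<phi> :: "'a::euclidean_space \<Rightarrow> real"
  assumes "quasi_concave \<phi>" "S \<in> sets lebesgue"
  shows "emeasure (density_measure \<phi>) S =
      (\<integral>\<^sup>+t. emeasure lebesgue (S \<inter> {x. t < \<phi> x}) * indicator {0<..} t \<partial>lborel)" (is ?cake)
    and "(\<lambda>t. emeasure lebesgue (S \<inter> {x. t < \<phi> x}) * indicator {0<..} t) \<in> borel_measurable borel" (is ?meas)
proof -
  note [measurable] = quasi_concave_imp_measurable[OF assms(1)] assms(2)
  let ?f = "\<lambda>x. ennreal (\<phi> x) * indicator S x"
  have f: "?f \<in> borel_measurable lebesgue" by measurable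
  have level: "emeasure lebesgue {x\<in>space lebesgue. ennreal t < ?f x} * indicator {0<..} t =
      emeasure lebesgue (S \<inter> {x. t < \<phi> x}) * indicator {0<..} t" for t :: real
  proof (cases "0 < t")
    case True
    then have "{x\<in>space lebesgue. ennreal t < ?f x} = S \<inter> {x. t < \<phi> x}"
      by (auto simp: indicator_def ennreal_less_iff split: if_splits)
    then show ?thesis by simp
  qed simp
  have "emeasure (density_measure \<phi>) S = (\<integral>\<^sup>+x. ?f x \<partial>lebesgue)"
    unfolding density_measure_def by (rule emeasure_density) measurable
  then show ?cake
    unfolding nn_integral_layer_cake[OF sigma_finite_lebesgue f] level .
  have "(\<lambda>t. emeasure lebesgue {x\<in>space lebesgue. ennreal t < ?f x} * indicator {0<..} t)
      \<in> borel_measurable borel"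
    using borel_measurable_superlevel[OF sigma_finite_lebesgue f] by measurable
  then show ?meas unfolding level .
qed

lemma convex_superlevel:
  assumes "quasi_concave \<phi>"
  shows "convex {x. t < \<phi> x}"
  unfolding convex_alt
proof clarsimp
  fix x y and u :: real
  assume *: "t < \<phi> x" "t < \<phi> y" "0 \<le> u" "u \<le> 1"
  show "t < \<phi> ((1 - u) *\<^sub>R x + u *\<^sub>R y)"
  proof (cases "u = 0 \<or> u = 1")
    case False
    then have "min (\<phi> x) (\<phi> y) \<le> \<phi> ((1 - u) *\<^sub>R x + u *\<^sub>R y)"
      using assms * unfolding quasi_concave_def by auto
    with * show ?thesis by linarith
  qed (use * in auto)
qed

text \<open>
  The origin is the midpoint of \<open>x\<close> and \<open>-x\<close>.
\<close>
lemma even_quasi_concave_max: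
  assumes "quasi_concave \<phi>" "even_function \<phi>"
  shows "\<phi> x \<le> \<phi> 0"
proof -
  have "min (\<phi> x) (\<phi> (- x)) \<le> \<phi> ((1 - 1/2) *\<^sub>R x + (1/2) *\<^sub>R (- x))"
    using assms(1)[unfolded quasi_concave_def, rule_format, of "1/2" x "- x"] by simp
  then show ?thesis using assms(2) by (simp add: even_function_def)
qed

text \<open>
  By continuity from below, the slice of \<open>T\<close> at some level \<open>t0 > 0\<close> is still larger than the slice of \<open>S\<close>
  at level 0. As slices shrink with the level, the gap \<open>d\<close> between these two numbers is a lower bound
  for the gap at each level below \<open>t0\<close>, so the integrals over the levels differ by at least
  \<open>d * t0\<close>. Finiteness of the smaller measure allows it to be cancelled.
\<close>
lemma level_gap_imp_strict:
  fixes \<phi> :: "'a::euclidean_space \<Rightarrow> real"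
  assumes \<phi>: "quasi_concave \<phi>"
    and S: "S \<in> sets lebesgue" "emeasure (density_measure \<phi>) S \<noteq> \<infinity>" and T: "T \<in> sets lebesgue"
    and le: "\<And>t. emeasure lebesgue (S \<inter> {x. t < \<phi> x}) \<le> emeasure lebesgue (T \<inter> {x. t < \<phi> x})"
    and gap: "emeasure lebesgue (S \<inter> {x. 0 < \<phi> x}) < emeasure lebesgue (T \<inter> {x. 0 < \<phi> x})"
  shows "emeasure (density_measure \<phi>) S \<noteq> emeasure (density_measure \<phi>) T"
proof
  assume eq: "emeasure (density_measure \<phi>) S = emeasure (density_measure \<phi>) T"
  let ?b = "\<lambda>t. emeasure lebesgue (S \<inter> {x. t < \<phi> x})" and ?a = "\<lambda>t. emeasure lebesgue (T \<inter> {x. t < \<phi> x})"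
  have sets: "X \<inter> {x. t < \<phi> x} \<in> sets lebesgue" if "X \<in> sets lebesgue" for X t
    using that convex_imp_sets_lebesgue[OF convex_superlevel[OF \<phi>]] by (rule sets.Int)
  have anti: "emeasure lebesgue (X \<inter> {x. t < \<phi> x}) \<le> emeasure lebesgue (X \<inter> {x. s < \<phi> x})"
    if "X \<in> sets lebesgue" "s \<le> t" for X s t
    using sets[OF that(1)] that(2) by (intro emeasure_mono) auto
  have "(\<Union>n::nat. T \<inter> {x. 1 / (real n + 1) < \<phi> x}) = T \<inter> {x. 0 < \<phi> x}"
  proof (intro equalityI subsetI)
    fix x assume x: "x \<in> T \<inter> {x. 0 < \<phi> x}"
    then obtain n where "inverse (real (Suc n)) < \<phi> x" using reals_Archimedean[of "\<phi> x"] by auto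
    with x show "x \<in> (\<Union>n::nat. T \<inter> {x. 1 / (real n + 1) < \<phi> x})"
      by (auto simp: inverse_eq_divide add.commute)
  next
    fix x assume "x \<in> (\<Union>n::nat. T \<inter> {x. 1 / (real n + 1) < \<phi> x})"
    then obtain n :: nat where "x \<in> T" "1 / (real n + 1) < \<phi> x" by auto
    moreover have "0 < 1 / (real n + 1)" by simp
    ultimately show "x \<in> T \<inter> {x. 0 < \<phi> x}" using less_trans by blast
  qed
  moreover have "(SUP n::nat. ?a (1 / (real n + 1))) = emeasure lebesgue (\<Union>n::nat. T \<inter> {x. 1 / (real n + 1) < \<phi> x})"
  proof (rule SUP_emeasure_incseq)
    show "range (\<lambda>n::nat. T \<inter> {x. 1 / (real n + 1) < \<phi> x}) \<subseteq> sets lebesgue"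
      using sets[OF T] by auto
    show "incseq (\<lambda>n::nat. T \<inter> {x. 1 / (real n + 1) < \<phi> x})"
    proof (rule incseq_SucI, rule subsetI)
      fix n x assume "x \<in> T \<inter> {x. 1 / (real n + 1) < \<phi> x}"
      moreover have "1 / (real (Suc n) + 1) \<le> 1 / (real n + 1)" by (simp add: field_simps)
      ultimately show "x \<in> T \<inter> {x. 1 / (real (Suc n) + 1) < \<phi> x}" by auto
    qed
  qed
  ultimately have "?b 0 < (SUP n::nat. ?a (1 / (real n + 1)))" using gap by simp
  then obtain n :: nat where n: "?b 0 < ?a (1 / (real n + 1))" by (auto simp only: less_SUP_iff)
  define t0 where "t0 = 1 / (real n + 1)"
  define d where "d = ?a t0 - ?b 0"
  have t0: "0 < t0" by (simp add: t0_def)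
  have d: "?b 0 + d = ?a t0" "0 < d"
    using n unfolding d_def t0_def[symmetric]
    by (auto simp: diff_gt_0_iff_gt_ennreal intro: add_diff_inverse_ennreal less_imp_le)
  have pointwise: "?b t * indicator {0<..} t + d * indicator {0<..<t0} t \<le> ?a t * indicator {0<..} t" for t
  proof (cases "0 < t \<and> t < t0")
    case True
    have "?b t + d \<le> ?b 0 + d" using True S(1) by (intro add_right_mono anti) auto
    also have "\<dots> \<le> ?a t" unfolding d(1) using True T by (intro anti) auto
    finally show ?thesis using True by simp
  next
    case False
    then show ?thesis using le[of t] by (auto simp: indicator_def)
  qed
  have "emeasure (density_measure \<phi>) S + d * emeasure lborel {0<..<t0} =
      (\<integral>\<^sup>+t. ?b t * indicator {0<..} t + d * indicator {0<..<t0} t \<partial>lborel)"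
    using density_measure_layer_cake[OF \<phi> S(1)]
    by (subst nn_integral_add) (auto simp: nn_integral_cmult_indicator)
  also have "\<dots> \<le> (\<integral>\<^sup>+t. ?a t * indicator {0<..} t \<partial>lborel)"
    by (intro nn_integral_mono pointwise)
  also have "\<dots> = emeasure (density_measure \<phi>) S"
    unfolding eq by (rule density_measure_layer_cake(1)[OF \<phi> T, symmetric])
  finally have "emeasure (density_measure \<phi>) S + d * ennreal t0 \<le> emeasure (density_measure \<phi>) S + 0"
    using t0 by simp
  then have "d * ennreal t0 \<le> 0"
    using S(2) by (subst (asm) ennreal_add_left_cancel_le) auto
  then show False using d(2) t0 by (simp add: ennreal_zero_less_mult_iff)
qed

theorem theorem2p2:
  fixes K :: "(real ^ 'n) set"
    and \<phi> :: "real ^ 'n \<Rightarrow> real"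
    and \<mu> :: "(real ^ 'n) measure"
  assumes "convex_body K"
    and "\<And>x. \<phi> x \<ge> 0"
    and "even_function \<phi>"
    and "quasi_concave \<phi>"
    and "\<mu> = density_measure \<phi>"
  shows "emeasure \<mu> (difference_body K) \<ge> emeasure \<mu> ((*\<^sub>R) 2 ` K) \<and>
    (emeasure \<mu> UNIV \<noteq> 0 \<longrightarrow>
       emeasure \<mu> (difference_body K) = emeasure \<mu> ((*\<^sub>R) 2 ` K) \<longrightarrow>
         centrally_symmetric (K \<inter> (*\<^sub>R) (1/2) ` supp \<phi>)) \<and>
    (origin_symmetric K \<longrightarrow>
       emeasure \<mu> (difference_body K) = emeasure \<mu> ((*\<^sub>R) 2 ` K))"
proof (intro conjI impI)
  have K: "compact K" "convex K" "interior K \<noteq> {}" using assms(1) by (auto simp: convex_body_def)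
  note \<phi> = \<open>quasi_concave \<phi>\<close>
  have [measurable]: "\<phi> \<in> borel_measurable lebesgue" by (rule quasi_concave_imp_measurable) fact
  have level: "convex {x. t < \<phi> x}" "\<And>x. x \<in> {x. t < \<phi> x} \<Longrightarrow> - x \<in> {x. t < \<phi> x}" for t
    using convex_superlevel[OF \<phi>] assms(3) by (auto simp: even_function_def)
  have meas: "(*\<^sub>R) 2 ` K \<in> sets lebesgue" "difference_body K \<in> sets lebesgue"
    using compact_scaling[OF K(1), of 2] compact_difference_body[OF K(1)] by (simp_all add: borel_compact)
  note slice = slice_inequality[OF K(1) level]
  show "emeasure \<mu> ((*\<^sub>R) 2 ` K) \<le> emeasure \<mu> (difference_body K)"
    unfolding assms(5) density_measure_layer_cake(1)[OF \<phi> meas(1)]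
      density_measure_layer_cake(1)[OF \<phi> meas(2)]
    by (intro nn_integral_mono mult_right_mono slice zero_le)
  show "emeasure \<mu> (difference_body K) = emeasure \<mu> ((*\<^sub>R) 2 ` K)" if "origin_symmetric K"
    using difference_body_symmetric[OF K(2) that] by simp
  assume nonzero: "emeasure \<mu> UNIV \<noteq> 0"
    and eq: "emeasure \<mu> (difference_body K) = emeasure \<mu> ((*\<^sub>R) 2 ` K)"
  let ?L = "{x. 0 < \<phi> x}"
  (* The density is bounded by its value at the origin, so the compact set 2 K has finite measure. *)
  have "emeasure \<mu> ((*\<^sub>R) 2 ` K) = (\<integral>\<^sup>+x. ennreal (\<phi> x) * indicator ((*\<^sub>R) 2 ` K) x \<partial>lebesgue)"
    unfolding assms(5) density_measure_def using meas by (intro emeasure_density) auto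
  also have "\<dots> \<le> (\<integral>\<^sup>+x. ennreal (\<phi> 0) * indicator ((*\<^sub>R) 2 ` K) x \<partial>lebesgue)"
    by (intro nn_integral_mono mult_right_mono ennreal_leI even_quasi_concave_max \<phi> assms(3) zero_le)
  also have "\<dots> = ennreal (\<phi> 0) * emeasure lebesgue ((*\<^sub>R) 2 ` K)"
    using meas by (intro nn_integral_cmult_indicator)
  also have "\<dots> < \<infinity>"
    using compact_emeasure_lborel_finite[OF compact_scaling[OF K(1), of 2]] compact_scaling[OF K(1), of 2]
    by (auto simp: ennreal_mult_less_top less_top borel_compact)
  finally have fin: "emeasure \<mu> ((*\<^sub>R) 2 ` K) \<noteq> \<infinity>" by simp
  have "\<not> emeasure lebesgue ((*\<^sub>R) 2 ` K \<inter> ?L) < emeasure lebesgue (difference_body K \<inter> ?L)"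
    using level_gap_imp_strict[OF \<phi> meas(1) _ meas(2) slice] fin eq assms(5) by auto
  then have slice_eq: "emeasure lebesgue (difference_body K \<inter> ?L) = emeasure lebesgue ((*\<^sub>R) 2 ` K \<inter> ?L)"
    using slice[of 0] by (intro antisym) auto
  (* Otherwise the density would vanish almost everywhere. *)
  have "\<not> negligible ?L"
  proof
    assume "negligible ?L"
    then have "AE x in lebesgue. x \<notin> ?L"
      by (intro AE_not_in) (simp add: negligible_iff_null_sets)
    then have "AE x in lebesgue. ennreal (\<phi> x) = 0"
      by (auto elim!: eventually_mono simp: ennreal_eq_0_iff not_less)
    then have "(\<integral>\<^sup>+x. ennreal (\<phi> x) \<partial>lebesgue) = 0"
      by (subst nn_integral_0_iff_AE) auto
    then show False using nonzero by (simp add: assms(5) density_measure_def emeasure_density)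
  qed
  then have "emeasure lebesgue (difference_body K \<inter> ?L) \<noteq> 0"
    using symmetric_slice_nonnull[OF K(3,1) level] by blast
  then obtain g where "\<And>x. x \<in> half_slice K ?L \<Longrightarrow> 2 *\<^sub>R g - x \<in> half_slice K ?L"
    using slice_equality[OF K(1,2) level slice_eq] by blast
  then have "centrally_symmetric (half_slice K ?L)" by (rule centrally_symmetricI)
  moreover have "half_slice K ?L = K \<inter> (*\<^sub>R) (1/2) ` supp \<phi>"
    by (auto simp: half_slice_def supp_def image_iff intro!: bexI[of _ "2 *\<^sub>R _"])
  ultimately show "centrally_symmetric (K \<inter> (*\<^sub>R) (1/2) ` supp \<phi>)" by simp
qed

end
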